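(* An $f$-configuration $(p_1,p_2,\alpha_1,\alpha_2)$, $(q_1,q_2,\beta_1,\beta_2)$ is $f$-connected if and only if $\alpha_1\alpha_2=\beta_1\beta_2$ and $\alpha_i\sim\beta_i$, $i=1,2$.
   Context: Let $V$ be a 3-dimensional complex vector space with a Hermitian form $\langle-,-\rangle$ (linear in the first argument) of signature $++-$. The same letter denotes a point of $\mathbb PV$ and a representative. A point $p$ has signature $\sigma p\in\{-1,0,1\}$, the sign of $\langle p,p\rangle$ (nonisotropic means $\sigma p\neq0$). $\mathbb S^1\subset\mathbb C$ is the unit circle, $\omega=e^{2\pi i/3}$, $\Omega=\{1,\omega,\omega^2\}$; a parameter is an element of $\mathbb S^1\setminus\Omega$. For nonisotropic $p$ and $\alpha\in\mathbb S^1$, $R_\alpha^p:x\mapsto(\alpha^{-2}-\alpha)\frac{\langle x,p\rangle}{\langle p,p\rangle}p+\alpha x$. $\mathrm L(p_1,p_2)$ is the complex projective line through $p_1\ne p_2$; a line $\mathbb PW$ is noneuclidean if the form on $W$ is nondegenerate. Geodesics. Let $L$ be a noneuclidean complex line. A geodesic in $L$ is the image in $\mathbb PV$ of $U\setminus\{0\}$, where $U$ is a real $2$-dimensional subspace on which the form is real and not identically zero, when this image lies in $L$. Through distinct nonorthogonal $p,q\in L$ there is a unique geodesic (given by $U=\mathbb Rp+\mathbb R\langle p,q\rangle q$). For nonorthogonal nonisotropic $p,q\in L$ of the same signature, $\mathrm G[p,q]$ is the arc of the geodesic through $p,q$ that joins $p$ and $q$ and does not contain the point of $L$ orthogonal to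 $p$ ($\mathrm G[p,p]=\{p\}$). For geodesics $G_1,G_2\subset L$ meeting at a nonisotropic $p$, $\angle_pG_1G_2\in[0,\pi)$ is the counterclockwise oriented angle from $G_1$ to $G_2$ at $p$ (orientation of $L$ given by its complex structure). $\mathrm{Arg}$ takes values in $[0,2\pi)$. Primitives and components. $J=\{e^{i\theta}:0<\theta<\pi/3\}$; the primitive of a parameter $\alpha$ is the unique $a\in J$ with $a^6=\alpha^3$. With $I_0=\{e^{i\theta}:0<\theta<2\pi/3\}$, $I_1=\omega I_0$, $I_2=\omega^2I_0$, $\alpha\sim\beta$ means that $\alpha,\beta$ lie in the same $I_j$. Associated geodesics. For distinct nonisotropic nonorthogonal $p_1,p_2$ with $L=\mathrm L(p_1,p_2)$ noneuclidean and parameters $\alpha_1,\alpha_2$ with primitives $a_1,a_2$, the geodesics associated to $R_{\alpha_2}^{p_2}R_{\alpha_1}^{p_1}$ are $G,G_1,G_2\subset L$, where $G$ passes through $p_1,p_2$, $G_i$ passes through $p_i$, $\angle_{p_1}G_1G=\mathrm{Arg}(a_1^3)$, $\angle_{p_2}GG_2=\mathrm{Arg}(a_2^3)$. An $f$-configuration consists of two tuples $(p_1,p_2,\alpha_1,\alpha_2)$, $(q_1,q_2,\beta_1,\beta_2)$ such that: (i) $p_1,p_2$ are distinct nonisotropic nonorthogonal points, and so are $q_1,q_2$, spanning the same noneuclidean line $\mathrm L(p_1,p_2)=\mathrm L(q_1,q_2)$; (ii) $\sigma p_i=\sigma q_i$ and $\langle p_i,q_i\rangle\neq0$, $i=1,2$;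 (iii) $\alpha_i,\beta_i\in\mathbb S^1\setminus\Omega$, $i=1,2$; (iv) $G_i=H_i$, $i=1,2$, where $G,G_1,G_2$ and $H,H_1,H_2$ are the geodesics associated to $R_{\alpha_2}^{p_2}R_{\alpha_1}^{p_1}$ and to $R_{\beta_2}^{q_2}R_{\beta_1}^{q_1}$ (so that $\angle_{p_1}G_1G=\mathrm{Arg}\,a_1^3$, $\angle_{p_2}GG_2=\mathrm{Arg}\,a_2^3$, $\angle_{q_1}G_1H=\mathrm{Arg}\,b_1^3$, $\angle_{q_2}HG_2=\mathrm{Arg}\,b_2^3$, with $a_i,b_i$ the primitives of $\alpha_i,\beta_i$); (v) neither $\mathrm G[p_1,q_1]$ nor $\mathrm G[p_2,q_2]$ contains an intersection point of $G_1,G_2$. The $f$-configuration is $f$-connected if there are continuous $\gamma_i:[a,b]\to G_i$, $i=1,2$, with $\gamma_i(a)=p_i$, $\gamma_i(b)=q_i$, $\sigma\gamma_i(t)=\sigma p_i$, $\gamma_1(t)\ne\gamma_2(t)$, $\langle\gamma_1(t),\gamma_2(t)\rangle\neq0$ for all $t$, such that the following holds. Let $G'_t$ be the geodesic through $\gamma_1(t),\gamma_2(t)$, let $h_i(t)\in J$ be defined by $\angle_{\gamma_1(t)}G_1G'_t=\mathrm{Arg}\,h_1(t)^3$, $\angle_{\gamma_2(t)}G'_tG_2=\mathrm{Arg}\,h_2(t)^3$, and let $\eta_i(t)\in\mathbb S^1$ be the parameter with $\eta_i(t)\sim\alpha_i$ and primitive $h_i(t)$. Then $\eta_1(t)\eta_2(t)=\alpha_1\alpha_2$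 for all $t\in[a,b]$.
   Formalization: Here f-connected also requires the deformation to end at the second tuple, η_i(b)=β_i for i=1,2; without this the "only if" part fails, e.g. for q_i=p_i, β_1=ωα_1, β_2=α_2 with constant γ_i. *)

theory Defs
  imports "HOL-Analysis.Analysis"
begin

(* In this file the subspaces named vec.subspace, vec.dim, vec.span are complex and use the
   complex scalar multiplication *s; the unqualified subspace, dim are real. *)

section \<open>The complex projective plane\<close>

typedef cp2 = "{S :: (complex ^ 3) set. vec.subspace S \<and> vec.dim S = 1}"
  morphisms cp2_line Abs_cp2
proof -
  have "vec.dim (vec.span {axis 1 1 :: complex ^ 3}) = card {axis 1 1 :: complex ^ 3}"
    by (intro vec.dim_span_eq_card_independent) (simp add: vec.dependent_single axis_eq_0_iff)
  then show ?thesis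
    using vec.subspace_span by (auto intro!: exI[of _ "vec.span {axis 1 1}"])
qed

definition proj :: "complex ^ 3 \<Rightarrow> cp2" where
  "proj v = Abs_cp2 (vec.span {v})"

(* A chosen representative. Everything below is independent of the choice. *)
definition rep :: "cp2 \<Rightarrow> complex ^ 3" where
  "rep p = (SOME v. v \<noteq> 0 \<and> v \<in> cp2_line p)"

text \<open>The quotient topology of the punctured vector space.\<close>

instantiation cp2 :: topological_space
begin

definition open_cp2 :: "cp2 set \<Rightarrow> bool" where
  "open_cp2 S \<longleftrightarrow> open {v. v \<noteq> 0 \<and> proj v \<in> S}"

instance
proof
  have "{v :: complex ^ 3. v \<noteq> 0 \<and> proj v \<in> UNIV} = - {0}" by auto
  then show "open (UNIV :: cp2 set)"
    unfolding open_cp2_def by (simp only: open_Compl closed_singleton)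
next
  fix S T :: "cp2 set"
  assume "open S" "open T"
  moreover have "{v. v \<noteq> 0 \<and> proj v \<in> S \<inter> T}
      = {v. v \<noteq> 0 \<and> proj v \<in> S} \<inter> {v. v \<noteq> 0 \<and> proj v \<in> T}" by auto
  ultimately show "open (S \<inter> T)"
    unfolding open_cp2_def by (simp only: open_Int)
next
  fix K :: "cp2 set set"
  assume "\<forall>S\<in>K. open S"
  moreover have "{v. v \<noteq> 0 \<and> proj v \<in> \<Union>K} = (\<Union>S\<in>K. {v. v \<noteq> 0 \<and> proj v \<in> S})" by auto
  ultimately show "open (\<Union>K)"
    unfolding open_cp2_def by (simp only: open_UN)
qed

end

definition proj_set :: "(complex ^ 3) set \<Rightarrow> cp2 set" where
  "proj_set W = proj ` (W - {0})"

definition cline :: "cp2 \<Rightarrow> cp2 \<Rightarrow> cp2 set" where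
  "cline p q = proj_set (vec.span {rep p, rep q})"


section \<open>Hermitian forms of signature ++-\<close>

type_synonym form = "complex ^ 3 \<Rightarrow> complex ^ 3 \<Rightarrow> complex"

definition hermitian_form :: "form \<Rightarrow> bool" where
  "hermitian_form h \<longleftrightarrow>
     (\<forall>x y z. h (x + y) z = h x z + h y z) \<and>
     (\<forall>c x y. h (c *s x) y = c * h x y) \<and>
     (\<forall>x y. h y x = cnj (h x y))"

definition signature_ppm :: "form \<Rightarrow> bool" where
  "signature_ppm h \<longleftrightarrow>
     (\<exists>e1 e2 e3. vec.span {e1, e2, e3} = UNIV \<and>
        h e1 e2 = 0 \<and> h e1 e3 = 0 \<and> h e2 e3 = 0 \<and>
        h e1 e1 = 1 \<and> h e2 e2 = 1 \<and> h e3 e3 = - 1)"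

definition orthog :: "form \<Rightarrow> cp2 \<Rightarrow> cp2 \<Rightarrow> bool" where
  "orthog h p q \<longleftrightarrow> h (rep p) (rep q) = 0"

(* The values h x x are real when h is Hermitian. *)
definition sig :: "form \<Rightarrow> cp2 \<Rightarrow> real" where
  "sig h p = sgn (Re (h (rep p) (rep p)))"

definition nonisotropic :: "form \<Rightarrow> cp2 \<Rightarrow> bool" where
  "nonisotropic h p \<longleftrightarrow> sig h p \<noteq> 0"

definition noneuclidean :: "form \<Rightarrow> cp2 set \<Rightarrow> bool" where
  "noneuclidean h L \<longleftrightarrow>
     (\<exists>W. vec.subspace W \<and> vec.dim W = 2 \<and> L = proj_set W \<and>
        (\<forall>x\<in>W. (\<forall>y\<in>W. h x y = 0) \<longrightarrow> x = 0))"


section \<open>Geodesics, arcs and angles\<close>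

definition geodesic_space :: "form \<Rightarrow> (complex ^ 3) set \<Rightarrow> bool" where
  "geodesic_space h U \<longleftrightarrow> subspace U \<and> dim U = 2 \<and>
     (\<forall>x\<in>U. \<forall>y\<in>U. h x y \<in> \<real>) \<and> (\<exists>x\<in>U. \<exists>y\<in>U. h x y \<noteq> 0)"

definition geodesic :: "form \<Rightarrow> cp2 set \<Rightarrow> cp2 set \<Rightarrow> bool" where
  "geodesic h L G \<longleftrightarrow> G \<subseteq> L \<and> (\<exists>U. geodesic_space h U \<and> G = proj_set U)"

(* Unique if p, q are distinct, nonorthogonal and span a noneuclidean line. *)
definition geodesic_through :: "form \<Rightarrow> cp2 \<Rightarrow> cp2 \<Rightarrow> cp2 set" where
  "geodesic_through h p q = (THE G. geodesic h (cline p q) G \<and> p \<in> G \<and> q \<in> G)"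

definition geodesic_arc :: "form \<Rightarrow> cp2 \<Rightarrow> cp2 \<Rightarrow> cp2 set" where
  "geodesic_arc h p q =
     (if p = q then {p}
      else (THE A. \<exists>g. arc g \<and> pathstart g = p \<and> pathfinish g = q \<and> A = path_image g \<and>
              A \<subseteq> geodesic_through h p q \<and> (\<forall>x\<in>A. \<not> orthog h x p)))"

(* For a nonisotropic p in L = PW with representative v, the tangent space of L at p is the
   complex line Hom (C v, W / C v), which is identified with the orthogonal complement of v in W
   by sending a homomorphism to the representative of its value at v that is orthogonal to v.
   Thus u is the velocity of the curve proj (v + t u) at t = 0, and tangent_line h p G is the
   real line tangent to G at p.  Any geodesic through p is proj_set U for some U that contains
   the given v, because U may be multiplied by a nonzero complex number. *)
definition tangent_line :: "form \<Rightarrow> cp2 \<Rightarrow> cp2 set \<Rightarrow> (complex ^ 3) set" where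
  "tangent_line h p G =
     {u. h u (rep p) = 0 \<and>
         (\<exists>U. geodesic_space h U \<and> G = proj_set U \<and> rep p \<in> U \<and> u \<in> U)}"

definition angle :: "form \<Rightarrow> cp2 \<Rightarrow> cp2 set \<Rightarrow> cp2 set \<Rightarrow> real" where
  "angle h p G1 G2 =
     (THE \<theta>. 0 \<le> \<theta> \<and> \<theta> < pi \<and> tangent_line h p G2 = (*s) (cis \<theta>) ` tangent_line h p G1)"


section \<open>Parameters, primitives and components\<close>

definition omega :: complex where
  "omega = cis (2 * pi / 3)"

definition is_parameter :: "complex \<Rightarrow> bool" where
  "is_parameter \<alpha> \<longleftrightarrow> norm \<alpha> = 1 \<and> \<alpha> \<notin> {1, omega, omega\<^sup>2}"

definition J_arc :: "complex set" where
  "J_arc = {cis \<theta> | \<theta>. 0 < \<theta> \<and> \<theta> < pi / 3}"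

definition primitive :: "complex \<Rightarrow> complex" where
  "primitive \<alpha> = (THE a. a \<in> J_arc \<and> a ^ 6 = \<alpha> ^ 3)"

definition I_arc :: "nat \<Rightarrow> complex set" where
  "I_arc j = {omega ^ j * cis \<theta> | \<theta>. 0 < \<theta> \<and> \<theta> < 2 * pi / 3}"

definition same_component :: "complex \<Rightarrow> complex \<Rightarrow> bool" where
  "same_component \<alpha> \<beta> \<longleftrightarrow> (\<exists>j\<in>{0, 1, 2}. \<alpha> \<in> I_arc j \<and> \<beta> \<in> I_arc j)"


section \<open>Configurations\<close>

type_synonym pair_data = "cp2 \<times> cp2 \<times> complex \<times> complex"

fun associated_geodesics ::
  "form \<Rightarrow> pair_data \<Rightarrow> cp2 set \<Rightarrow> cp2 set \<Rightarrow> cp2 set \<Rightarrow> bool" where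
  "associated_geodesics h (p1, p2, \<alpha>1, \<alpha>2) G G1 G2 \<longleftrightarrow>
     geodesic h (cline p1 p2) G \<and> p1 \<in> G \<and> p2 \<in> G \<and>
     geodesic h (cline p1 p2) G1 \<and> p1 \<in> G1 \<and>
     geodesic h (cline p1 p2) G2 \<and> p2 \<in> G2 \<and>
     angle h p1 G1 G = Arg2pi (primitive \<alpha>1 ^ 3) \<and>
     angle h p2 G G2 = Arg2pi (primitive \<alpha>2 ^ 3)"

fun f_configuration :: "form \<Rightarrow> pair_data \<Rightarrow> pair_data \<Rightarrow> bool" where
  "f_configuration h (p1, p2, \<alpha>1, \<alpha>2) (q1, q2, \<beta>1, \<beta>2) \<longleftrightarrow>
     p1 \<noteq> p2 \<and> nonisotropic h p1 \<and> nonisotropic h p2 \<and> \<not> orthog h p1 p2 \<and>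
     q1 \<noteq> q2 \<and> nonisotropic h q1 \<and> nonisotropic h q2 \<and> \<not> orthog h q1 q2 \<and>
     cline p1 p2 = cline q1 q2 \<and> noneuclidean h (cline p1 p2) \<and>
     sig h p1 = sig h q1 \<and> sig h p2 = sig h q2 \<and>
     \<not> orthog h p1 q1 \<and> \<not> orthog h p2 q2 \<and>
     is_parameter \<alpha>1 \<and> is_parameter \<alpha>2 \<and> is_parameter \<beta>1 \<and> is_parameter \<beta>2 \<and>
     (\<exists>G H G1 G2.
        associated_geodesics h (p1, p2, \<alpha>1, \<alpha>2) G G1 G2 \<and>
        associated_geodesics h (q1, q2, \<beta>1, \<beta>2) H G1 G2 \<and>
        geodesic_arc h p1 q1 \<inter> (G1 \<inter> G2) = {} \<and>
        geodesic_arc h p2 q2 \<inter> (G1 \<inter> G2) = {})"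

(* The two equations for eta1 b and eta2 b say that the deformation ends at the second tuple; the
   corresponding equations at a are automatic.  They are not redundant: the geodesics involve the
   beta's only through their primitives, and beta, omega * beta, omega^2 * beta have the same
   primitive. *)
fun f_connected :: "form \<Rightarrow> pair_data \<Rightarrow> pair_data \<Rightarrow> bool" where
  "f_connected h (p1, p2, \<alpha>1, \<alpha>2) (q1, q2, \<beta>1, \<beta>2) \<longleftrightarrow>
     (\<exists>G G1 G2. associated_geodesics h (p1, p2, \<alpha>1, \<alpha>2) G G1 G2 \<and>
       (\<exists>(a :: real) b \<gamma>1 \<gamma>2 h1 h2 \<eta>1 \<eta>2.
          a < b \<and> continuous_on {a..b} \<gamma>1 \<and> continuous_on {a..b} \<gamma>2 \<and>
          \<gamma>1 a = p1 \<and> \<gamma>2 a = p2 \<and> \<gamma>1 b = q1 \<and> \<gamma>2 b = q2 \<and>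
          (\<forall>t\<in>{a..b}.
             \<gamma>1 t \<in> G1 \<and> \<gamma>2 t \<in> G2 \<and>
             sig h (\<gamma>1 t) = sig h p1 \<and> sig h (\<gamma>2 t) = sig h p2 \<and>
             \<gamma>1 t \<noteq> \<gamma>2 t \<and> \<not> orthog h (\<gamma>1 t) (\<gamma>2 t) \<and>
             h1 t \<in> J_arc \<and> h2 t \<in> J_arc \<and>
             angle h (\<gamma>1 t) G1 (geodesic_through h (\<gamma>1 t) (\<gamma>2 t)) = Arg2pi (h1 t ^ 3) \<and>
             angle h (\<gamma>2 t) (geodesic_through h (\<gamma>1 t) (\<gamma>2 t)) G2 = Arg2pi (h2 t ^ 3) \<and>
             is_parameter (\<eta>1 t) \<and> same_component (\<eta>1 t) \<alpha>1 \<and> primitive (\<eta>1 t) = h1 t \<and>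
             is_parameter (\<eta>2 t) \<and> same_component (\<eta>2 t) \<alpha>2 \<and> primitive (\<eta>2 t) = h2 t \<and>
             \<eta>1 t * \<eta>2 t = \<alpha>1 * \<alpha>2) \<and>
          \<eta>1 b = \<beta>1 \<and> \<eta>2 b = \<beta>2))"

end

theory Submission
  imports Defs
begin

text \<open>Let \<open>U1\<close>, \<open>U2\<close> be real planes representing \<open>G1\<close>, \<open>G2\<close>. For vectors \<open>u1\<close> in \<open>U1\<close> and \<open>u2\<close> in
  \<open>U2\<close>, the two angles at \<open>u1\<close> and \<open>u2\<close> add up to \<open>2 arg f\<close> plus a constant (modulo \<open>2 \<pi>\<close>), where
  \<open>f = h u1 u2\<close>. Move \<open>u1\<close> along the segment from \<open>p1\<close> to \<open>q1\<close> in \<open>U1\<close> with parameter \<open>x\<close>, and \<open>u2\<close>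
  along the segment from \<open>p2\<close> to \<open>q2\<close> in \<open>U2\<close> with parameter \<open>y\<close>. Then \<open>f\<close> is biaffine in \<open>(x, y)\<close>,
  and the hypothesis on the arcs says that neither angle vanishes on the unit square. Hence the angle
  sum is continuous there with values in \<open>(0, 2 \<pi>)\<close>, so if it is equal at \<open>(0, 0)\<close> and \<open>(1, 1)\<close>, then
  \<open>f(1, 1)\<close> is a positive multiple of \<open>f(0, 0)\<close>. The curve on which \<open>f / f(0, 0)\<close> is real is therefore a
  hyperbola \<open>a x (1 - y) + b y (1 - x) = 0\<close> through both corners; \<open>a\<close> and \<open>b\<close> have opposite signs, so it
  stays inside the square, and the angle sum is constant along it.\<close>

section \<open>The projective plane\<close>

lemma scaleR_eq_scale: "r *\<^sub>R (v :: complex ^ 'n) = complex_of_real r *s v"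
  by (auto simp: vec_eq_iff complex_eq_iff)

lemma cp2_line_proj:
  assumes "v \<noteq> 0"
  shows "cp2_line (proj v) = vec.span {v}"
proof -
  have "vec.dim (vec.span {v}) = card {v}"
    using assms by (intro vec.dim_span_eq_card_independent) (simp add: vec.dependent_single)
  then show ?thesis
    unfolding proj_def by (intro Abs_cp2_inverse) simp
qed

lemma rep_nonzero: "rep p \<noteq> 0" and rep_in_line: "rep p \<in> cp2_line p"
proof -
  have "vec.subspace (cp2_line p)" "vec.dim (cp2_line p) = 1"
    using cp2_line[of p] by auto
  then have "\<exists>v. v \<noteq> 0 \<and> v \<in> cp2_line p"
    using vec.dim_eq_0[of "cp2_line p"] by fastforce
  then show "rep p \<noteq> 0" "rep p \<in> cp2_line p"
    unfolding rep_def by (metis (mono_tags, lifting) someI_ex)+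
qed

lemma proj_rep: "proj (rep p) = p"
proof -
  have "vec.subspace (cp2_line p)" "vec.dim (cp2_line p) = 1"
    using cp2_line[of p] by auto
  moreover have "vec.span {rep p} \<subseteq> cp2_line p"
    using calculation rep_in_line by (intro vec.span_minimal) auto
  moreover have "vec.dim (vec.span {rep p}) = 1"
    using cp2_line_proj[OF rep_nonzero] cp2_line[of "proj (rep p)"] by auto
  ultimately have "vec.span {rep p} = cp2_line p"
    by (intro vec.subspace_dim_equal) auto
  then show ?thesis
    by (metis cp2_line_inverse proj_def)
qed

lemma proj_eq_iff:
  assumes "v \<noteq> 0" "w \<noteq> 0"
  shows "proj v = proj w \<longleftrightarrow> (\<exists>c. w = c *s v)"
proof
  assume "proj v = proj w"
  then have "w \<in> vec.span {v}"
    using cp2_line_proj assms vec.span_base by (metis singletonI)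
  then show "\<exists>c. w = c *s v"
    by (auto simp: vec.span_singleton)
next
  assume "\<exists>c. w = c *s v"
  then obtain c where c: "w = c *s v" by blast
  with assms have "c \<noteq> 0" by auto
  with c have "v = (1 / c) *s w" by simp
  then have "vec.span {v} = vec.span {w}"
    using c by (subst vec.span_eq) (metis empty_subsetI insert_subset singletonI vec.span_base vec.span_scale)
  then show "proj v = proj w" by (simp add: proj_def)
qed

lemma proj_scale: "c \<noteq> 0 \<Longrightarrow> v \<noteq> 0 \<Longrightarrow> proj (c *s v) = proj v"
  by (metis proj_eq_iff vec.scale_eq_0_iff)

lemma proj_cases:
  obtains v where "v \<noteq> 0" "p = proj v"
  using proj_rep rep_nonzero by metis

lemma rep_proj:
  assumes "v \<noteq> 0"
  obtains c where "c \<noteq> 0" "rep (proj v) = c *s v"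
proof -
  obtain c where "rep (proj v) = c *s v"
    using proj_eq_iff[OF assms rep_nonzero] proj_rep by metis
  moreover have "c \<noteq> 0"
    using calculation rep_nonzero by (metis vec.scale_zero_left)
  ultimately show thesis using that by blast
qed

lemma proj_in_proj_set:
  assumes "vec.subspace W" "v \<noteq> 0"
  shows "proj v \<in> proj_set W \<longleftrightarrow> v \<in> W"
proof
  assume "proj v \<in> proj_set W"
  then obtain w where "w \<in> W" "w \<noteq> 0" "proj v = proj w"
    by (auto simp: proj_set_def)
  then show "v \<in> W"
    using assms proj_eq_iff by (metis vec.subspace_scale)
qed (use assms in \<open>auto simp: proj_set_def\<close>)

text \<open>Identifies the plane hidden behind the existential quantifier in
  \<open>noneuclidean\<close> with a plane already at hand.\<close>

lemma proj_set_eq_imp_eq: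
  assumes "vec.subspace W" "vec.subspace W'" "proj_set W = proj_set W'"
  shows "W = W'"
proof -
  have "v \<in> W \<longleftrightarrow> v \<in> W'" for v
    using assms proj_in_proj_set by (cases "v = 0") (auto simp: vec.subspace_0)
  then show ?thesis by blast
qed

lemma proj_set_scale:
  assumes "c \<noteq> 0"
  shows "proj_set ((*s) c ` U) = proj_set U"
proof -
  have "(*s) c ` U - {0} = (*s) c ` (U - {0})"
    using assms by auto
  then have "proj_set ((*s) c ` U) = (\<lambda>v. proj (c *s v)) ` (U - {0})"
    by (simp add: proj_set_def image_image)
  also have "\<dots> = proj ` (U - {0})"
    using assms by (intro image_cong) (auto simp: proj_scale)
  finally show ?thesis by (simp add: proj_set_def)
qed

lemma continuous_on_proj:
  assumes "continuous_on S v" "\<And>t. t \<in> S \<Longrightarrow> v t \<noteq> 0"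
  shows "continuous_on S (\<lambda>t. proj (v t))"
  unfolding continuous_on_open_invariant
proof (intro allI impI)
  fix B :: "cp2 set"
  assume "open B"
  then have "open {v. v \<noteq> 0 \<and> proj v \<in> B}"
    by (simp add: open_cp2_def)
  then obtain A where A: "open A" "A \<inter> S = v -` {v. v \<noteq> 0 \<and> proj v \<in> B} \<inter> S"
    using assms(1) unfolding continuous_on_open_invariant by blast
  moreover have "v -` {v. v \<noteq> 0 \<and> proj v \<in> B} \<inter> S = (\<lambda>t. proj (v t)) -` B \<inter> S"
    using assms(2) by auto
  ultimately show "\<exists>A. open A \<and> A \<inter> S = (\<lambda>t. proj (v t)) -` B \<inter> S"
    by auto
qed

text \<open>In the quotient topology a set of points is open exactly when its pull-back to nonzero
  vectors is. The first assumption makes \<open>S\<close> itself open, so continuity on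
  \<open>S\<close> amounts to open preimages.\<close>

lemma continuous_on_cp2:
  assumes "open {v. v \<noteq> 0 \<and> proj v \<in> S}"
    and "continuous_on {v. v \<noteq> 0 \<and> proj v \<in> S} (\<lambda>v. F (proj v))"
  shows "continuous_on S F"
proof -
  have "open S" using assms(1) by (simp add: open_cp2_def)
  have "open (F -` B \<inter> S)" if "open B" for B
  proof -
    have "open ((\<lambda>v. F (proj v)) -` B \<inter> {v. v \<noteq> 0 \<and> proj v \<in> S})"
      using assms that by (simp add: continuous_on_open_vimage)
    moreover have "(\<lambda>v. F (proj v)) -` B \<inter> {v. v \<noteq> 0 \<and> proj v \<in> S} = {v. v \<noteq> 0 \<and> proj v \<in> F -` B \<inter> S}"
      by auto
    ultimately show ?thesis by (simp add: open_cp2_def)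
  qed
  then show ?thesis
    using \<open>open S\<close> by (simp add: continuous_on_open_vimage)
qed

lemma cline_proj:
  assumes "v \<noteq> 0" "w \<noteq> 0"
  shows "cline (proj v) (proj w) = proj_set (vec.span {v, w})"
proof -
  obtain c where c: "c \<noteq> 0" "rep (proj v) = c *s v" using assms rep_proj by blast
  obtain d where d: "d \<noteq> 0" "rep (proj w) = d *s w" using assms rep_proj by blast
  have "c *s v \<in> vec.span {v, w}" "d *s w \<in> vec.span {v, w}"
    by (auto intro: vec.span_scale vec.span_base)
  moreover have "(1 / c) *s (c *s v) \<in> vec.span {c *s v, d *s w}"
    by (rule vec.span_scale) (simp add: vec.span_base)
  moreover have "(1 / d) *s (d *s w) \<in> vec.span {c *s v, d *s w}"
    by (rule vec.span_scale) (simp add: vec.span_base)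
  ultimately have "v \<in> vec.span {c *s v, d *s w}" "w \<in> vec.span {c *s v, d *s w}"
    "c *s v \<in> vec.span {v, w}" "d *s w \<in> vec.span {v, w}"
    using c(1) d(1) by auto
  then have "vec.span {c *s v, d *s w} = vec.span {v, w}"
    by (simp add: vec.span_eq)
  then show ?thesis unfolding cline_def c d by simp
qed

lemma scaleR_scale_commute: "r *\<^sub>R (c *s v) = c *s (r *\<^sub>R (v :: complex ^ 'n))"
  by (simp add: scaleR_eq_scale mult.commute)

lemma linear_scale: "linear ((*s) c :: complex ^ 'n \<Rightarrow> complex ^ 'n)"
  by (rule linearI) (simp_all add: vec.scale_right_distrib scaleR_scale_commute)

lemma in_span_pair: "x \<in> span {v, w} \<longleftrightarrow> (\<exists>a b. x = a *\<^sub>R v + b *\<^sub>R w)"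
proof -
  have "x \<in> span {v, w} \<longleftrightarrow> (\<exists>a b. x - a *\<^sub>R v = b *\<^sub>R w)"
    by (auto simp: span_breakdown_eq span_singleton)
  then show ?thesis by (simp add: diff_eq_eq add.commute)
qed

text \<open>Dividing by \<open>cis \<phi>\<close> makes the sine of \<open>\<theta> - \<phi>\<close>
  vanish, and this difference has modulus less than pi. This is the uniqueness behind the definite
  description in \<open>angle\<close>.\<close>

lemma real_cis_unique:
  assumes "0 \<le> \<theta>" "\<theta> < pi" "0 \<le> \<phi>" "\<phi> < pi" "r \<noteq> 0"
    and "complex_of_real r * cis \<theta> = complex_of_real s * cis \<phi>"
  shows "\<theta> = \<phi>"
proof -
  have "complex_of_real r * (cis \<theta> * cis (- \<phi>)) = complex_of_real s * (cis \<phi> * cis (- \<phi>))"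
    using assms(6) by (simp add: mult.assoc[symmetric])
  then have "complex_of_real r * cis (\<theta> - \<phi>) = complex_of_real s"
    by (simp add: cis_mult)
  then have "Im (complex_of_real r * cis (\<theta> - \<phi>)) = 0" by simp
  then have "sin (\<theta> - \<phi>) = 0" using assms by simp
  moreover have "\<bar>\<theta> - \<phi>\<bar> < pi" using assms by auto
  ultimately show ?thesis
    using sin_gt_zero[of "\<theta> - \<phi>"] sin_gt_zero[of "\<phi> - \<theta>"] sin_minus[of "\<theta> - \<phi>"]
    by (cases "\<theta> < \<phi>"; cases "\<phi> < \<theta>") auto
qed


section \<open>Geodesics, angles and arcs\<close>

text \<open>The angle in \<open>(0, \<pi>)\<close> of the real line through a nonreal number.\<close>

definition ang :: "complex \<Rightarrow> real" where
  "ang z = (if Im z > 0 then Arg z else Arg (- z))"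

text \<open>Multiplication by the sign of the imaginary part moves \<open>z\<close> to the upper
  half-plane, where \<open>Arg\<close> lies between 0 and pi. The price is a modulus with a sign,
  which is harmless for unoriented real lines.\<close>

lemma ang_polar:
  assumes "Im z \<noteq> 0"
  shows "0 < ang z" "ang z < pi" "z = of_real (sgn (Im z) * cmod z) * cis (ang z)"
proof -
  define s where "s = sgn (Im z)"
  have s: "s = 1 \<or> s = - 1" using assms by (auto simp: s_def sgn_if)
  have ang: "ang z = Arg (of_real s * z)" "Im (of_real s * z) > 0"
    using assms by (cases "Im z > 0"; simp add: s_def ang_def)+
  show "0 < ang z" "ang z < pi"
    using ang Arg_lt_pi[of "of_real s * z"] by simp_all
  have "of_real s * z = of_real (cmod (of_real s * z)) * cis (ang z)"
    using rcis_cmod_Arg[of "of_real s * z"] by (simp add: ang(1) rcis_def)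
  moreover have "cmod (of_real s * z) = cmod z" using s by (auto simp: norm_mult)
  ultimately have "of_real s * (of_real s * z) = of_real s * (of_real (cmod z) * cis (ang z))"
    by simp
  moreover have "of_real s * (of_real s * z) = z" using s by auto
  ultimately show "z = of_real (sgn (Im z) * cmod z) * cis (ang z)"
    by (simp add: s_def[symmetric] mult.assoc)
qed

section \<open>The form evaluated on representatives\<close>

locale hermitian =
  fixes h :: form
  assumes hermitian_form: "hermitian_form h"
begin

lemma add_left: "h (x + y) z = h x z + h y z"
  and scale_left: "h (c *s x) y = c * h x y"
  and commute: "h y x = cnj (h x y)"
  using hermitian_form unfolding hermitian_form_def by blast+

lemma add_right: "h x (y + z) = h x y + h x z"
  by (metis add_left commute complex_cnj_add)

lemma scale_right: "h x (c *s y) = cnj c * h x y"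
  by (metis scale_left commute complex_cnj_mult)

lemma zero_left: "h 0 x = 0" and zero_right: "h x 0 = 0"
  using scale_left[of 0 x x] scale_right[of x 0 x] by simp_all

lemma scaleR_left: "h (r *\<^sub>R x) y = of_real r * h x y"
  and scaleR_right: "h x (r *\<^sub>R y) = of_real r * h x y"
  by (simp_all add: scaleR_eq_scale scale_left scale_right)

lemma diff_left: "h (x - y) z = h x z - h y z"
  and diff_right: "h z (x - y) = h z x - h z y"
  using add_left[of "x - y" y z] add_right[of z "x - y" y] by simp_all

lemmas form_simps = add_left add_right scale_left scale_right scaleR_left scaleR_right
  diff_left diff_right zero_left zero_right

lemma self_real: "h x x = of_real (Re (h x x))"
  using commute[of x x] by (metis Reals_cnj_iff of_real_Re)

lemma eq_0_commute: "h x y = 0 \<longleftrightarrow> h y x = 0"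
  by (metis commute complex_cnj_zero)

lemma orthog_proj:
  assumes "v \<noteq> 0" "w \<noteq> 0"
  shows "orthog h (proj v) (proj w) \<longleftrightarrow> h v w = 0"
proof -
  obtain c where "c \<noteq> 0" "rep (proj v) = c *s v" using assms rep_proj by blast
  moreover obtain d where "d \<noteq> 0" "rep (proj w) = d *s w" using assms rep_proj by blast
  ultimately show ?thesis by (simp add: orthog_def form_simps)
qed

lemma sig_proj:
  assumes "v \<noteq> 0"
  shows "sig h (proj v) = sgn (Re (h v v))"
proof -
  obtain c where c: "c \<noteq> 0" "rep (proj v) = c *s v" using assms rep_proj by blast
  have "h (c *s v) (c *s v) = of_real ((cmod c)\<^sup>2) * h v v"
    by (simp add: form_simps complex_norm_square del: of_real_power)
  then have "Re (h (c *s v) (c *s v)) = (cmod c)\<^sup>2 * Re (h v v)"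
    by (metis Re_complex_of_real of_real_mult self_real)
  then show ?thesis using c by (simp add: sig_def sgn_mult)
qed

lemma nonisotropic_proj: "v \<noteq> 0 \<Longrightarrow> nonisotropic h (proj v) \<longleftrightarrow> h v v \<noteq> 0"
  by (metis nonisotropic_def sig_proj sgn_0_0 self_real of_real_0 zero_complex.sel(1))

section \<open>Real planes representing geodesics\<close>

lemma geodesic_space_scale:
  assumes "geodesic_space h U" "c \<noteq> 0"
  shows "geodesic_space h ((*s) c ` U)"
proof -
  have U: "subspace U" "dim U = 2" "\<And>x y. x \<in> U \<Longrightarrow> y \<in> U \<Longrightarrow> h x y \<in> \<real>"
    using assms unfolding geodesic_space_def by blast+
  obtain x y where xy: "x \<in> U" "y \<in> U" "h x y \<noteq> 0"
    using assms unfolding geodesic_space_def by blast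
  have *: "h (c *s x) (c *s y) = of_real ((cmod c)\<^sup>2) * h x y" for x y
    by (simp add: form_simps complex_norm_square del: of_real_power)
  have "dim ((*s) c ` U) = dim U"
    using assms(2) by (intro dim_image_eq linear_scale) (auto simp: inj_on_def)
  moreover have "h (c *s x) (c *s y) \<noteq> 0"
    using xy(3) assms(2) unfolding * by simp
  moreover have "h (c *s x) (c *s y) \<in> \<real>" if "x \<in> U" "y \<in> U" for x y
    unfolding * using U(3)[OF that] by (intro Reals_mult) auto
  ultimately show ?thesis
    using U xy by (auto simp: geodesic_space_def linear_subspace_image linear_scale)
qed

text \<open>Multiplying the plane by a complex number does not change the geodesic, and this freedom
  is used to make the plane contain the prescribed representative \<open>v\<close>.\<close>

lemma geodesic_obtain_space:
  assumes "geodesic h L G" "v \<noteq> 0" "proj v \<in> G"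
  obtains U where "geodesic_space h U" "G = proj_set U" "v \<in> U" "proj_set U \<subseteq> L"
proof -
  obtain U where U: "geodesic_space h U" "G = proj_set U" "G \<subseteq> L"
    using assms(1) unfolding geodesic_def by blast
  obtain u where u: "u \<in> U" "u \<noteq> 0" "proj u = proj v"
    using assms(3) unfolding U(2) proj_set_def by fastforce
  then obtain c where c: "v = c *s u" using proj_eq_iff assms(2) by metis
  then have "c \<noteq> 0" using assms(2) by auto
  then show thesis
    using that[of "(*s) c ` U"] geodesic_space_scale[OF U(1)] proj_set_scale[of c U] U u(1) c by auto
qed

text \<open>One Gram-Schmidt step. It stays inside the real plane because the form is real there, so
  the coefficient is real.\<close>

lemma geodesic_space_basis:
  assumes U: "geodesic_space h U" and v: "v \<in> U" "h v v \<noteq> 0"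
  obtains w where "w \<in> U" "w \<noteq> 0" "h w v = 0" "U = span {v, w}"
proof -
  have sub: "subspace U" and dim: "dim U = 2"
    and re: "\<And>x y. x \<in> U \<Longrightarrow> y \<in> U \<Longrightarrow> h x y \<in> \<real>"
    using U unfolding geodesic_space_def by blast+
  have "v \<noteq> 0" using v(2) zero_left by auto
  have "\<not> U \<subseteq> span {v}"
    using dim dim_le_card[of U "{v}"] by auto
  then obtain w0 where w0: "w0 \<in> U" "w0 \<notin> span {v}" by blast
  define w where "w = w0 - (Re (h w0 v) / Re (h v v)) *\<^sub>R v"
  have "w \<in> U"
    using sub v(1) w0(1) by (simp add: w_def subspace_diff subspace_scale)
  have "w \<notin> span {v}"
  proof
    assume "w \<in> span {v}"
    then have "w + (Re (h w0 v) / Re (h v v)) *\<^sub>R v \<in> span {v}"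
      by (metis span_add span_scale span_base singletonI)
    then show False using w0(2) by (simp add: w_def)
  qed
  moreover have "0 \<in> span {v}" "v \<in> span {v}" by (simp_all add: span_zero span_base)
  ultimately have "w \<noteq> 0" "w \<noteq> v" by blast+
  have vv: "complex_of_real (Re (h v v)) = h v v" by (rule self_real[symmetric])
  have "complex_of_real (Re (h w0 v)) = h w0 v" using re[OF w0(1) v(1)] by simp
  then have "h w v = 0"
    using v(2) vv by (simp add: w_def form_simps)
  have "independent {w, v}"
    using \<open>w \<notin> span {v}\<close> \<open>v \<noteq> 0\<close> \<open>w \<noteq> v\<close> by (simp add: independent_insert)
  then have "dim (span {v, w}) = 2"
    using \<open>w \<noteq> v\<close> by (metis card_2_iff dim_span_eq_card_independent insert_commute)
  moreover have "span {v, w} \<subseteq> U"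
    using sub v(1) \<open>w \<in> U\<close> by (intro span_minimal) auto
  ultimately have "span {v, w} = U"
    using sub dim by (intro subspace_dim_equal) auto
  then show thesis using that \<open>w \<in> U\<close> \<open>w \<noteq> 0\<close> \<open>h w v = 0\<close> by blast
qed

lemma geodesic_space_span:
  assumes "v \<noteq> 0" "\<And>c. w \<noteq> c *s v" "h v w \<in> \<real>" "h v w \<noteq> 0"
  shows "geodesic_space h (span {v, w})"
proof -
  have "w \<notin> span {v}" using assms(2) by (auto simp: span_singleton scaleR_eq_scale)
  moreover have "w \<noteq> v" using assms(2)[of 1] by auto
  ultimately have "independent {w, v}"
    using assms(1) by (simp add: independent_insert)
  then have "dim (span {v, w}) = 2"
    using \<open>w \<noteq> v\<close> by (metis card_2_iff dim_span_eq_card_independent insert_commute)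
  moreover have "h w v \<in> \<real>" using assms(3) by (metis commute Reals_cnj_iff)
  moreover have "h v v \<in> \<real>" "h w w \<in> \<real>" using self_real by (metis Reals_of_real)+
  ultimately have "dim (span {v, w}) = 2" "\<forall>x\<in>span {v, w}. \<forall>y\<in>span {v, w}. h x y \<in> \<real>"
    using assms(3) by (auto simp: in_span_pair form_simps intro!: Reals_add Reals_mult)
  moreover have "v \<in> span {v, w}" "w \<in> span {v, w}" by (auto intro: span_base)
  ultimately show ?thesis
    unfolding geodesic_space_def using assms(4) subspace_span by blast
qed

text \<open>A vector \<open>x\<close> of \<open>U\<close> has a complex multiple
  \<open>c *s x\<close> in \<open>U'\<close>. If \<open>x\<close> is not orthogonal to
  \<open>v\<close>, both pairings with \<open>v\<close> are nonzero reals, so \<open>c\<close> is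
  real and \<open>x\<close> itself lies in \<open>U'\<close>. A vector orthogonal to
  \<open>v\<close> is treated by adding \<open>v\<close> to it.\<close>

lemma geodesic_space_subset:
  assumes U: "geodesic_space h U" and U': "geodesic_space h U'"
    and v: "v \<in> U" "v \<in> U'" "h v v \<noteq> 0" and eq: "proj_set U = proj_set U'"
  shows "U \<subseteq> U'"
proof -
  have sub: "subspace U" "subspace U'" using U U' by (auto simp: geodesic_space_def)
  have re: "h x v \<in> \<real>" if "x \<in> U \<or> x \<in> U'" for x
    using U U' v that by (auto simp: geodesic_space_def)
  have nonorth: "x \<in> U'" if x: "x \<in> U" "h x v \<noteq> 0" for x
  proof -
    have "x \<noteq> 0" using x zero_left by auto
    then have "proj x \<in> proj_set U" using x(1) by (simp add: proj_set_def)
    then have "proj x \<in> proj_set U'" by (simp only: eq)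
    then obtain y where y: "y \<in> U'" "y \<noteq> 0" "proj x = proj y" by (auto simp: proj_set_def)
    then obtain c where c: "y = c *s x" using proj_eq_iff \<open>x \<noteq> 0\<close> by blast
    have "c \<noteq> 0" using c y by auto
    have "c * h x v \<in> \<real>" using re[of y] y(1) by (simp add: c form_simps)
    then have "c * h x v / h x v \<in> \<real>" using re[of x] x(1) Reals_divide by blast
    then have "c \<in> \<real>" using x(2) by simp
    then have "y = Re c *\<^sub>R x" by (simp add: c scaleR_eq_scale)
    then have "(1 / Re c) *\<^sub>R y = x"
      using y(2) by auto
    then show "x \<in> U'" using sub(2) y(1) subspace_scale by metis
  qed
  show "U \<subseteq> U'"
  proof
    fix x assume x: "x \<in> U"
    show "x \<in> U'"
    proof (cases "h x v = 0")
      case True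
      then have "x + v \<in> U'"
        using sub x v by (intro nonorth) (auto simp: subspace_add form_simps)
      then show ?thesis using sub(2) v(2) by (metis add_diff_cancel_right' subspace_diff)
    qed (use nonorth x in blast)
  qed
qed

section \<open>Tangent lines and angles\<close>

lemma tangent_line_proj:
  assumes U: "geodesic_space h U" and v: "v \<in> U" "h v v \<noteq> 0"
    and w: "w \<in> U" "w \<noteq> 0" "h w v = 0"
    and c: "c \<noteq> 0" "rep (proj v) = c *s v"
  shows "tangent_line h (proj v) (proj_set U) = range (\<lambda>b. (of_real b * c) *s w)"
proof -
  have sub: "subspace U" using U by (auto simp: geodesic_space_def)
  obtain w' where w': "w' \<in> U" "w' \<noteq> 0" "h w' v = 0" "U = span {v, w'}"
    using geodesic_space_basis[OF U v] by blast
  obtain a b where ab: "w = a *\<^sub>R v + b *\<^sub>R w'" using w(1) w'(4) in_span_pair by blast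
  then have "a = 0" using w(3) v(2) w'(3) by (simp add: form_simps)
  with ab w(2) have b: "w = b *\<^sub>R w'" "b \<noteq> 0" by auto
  have perp: "x \<in> U \<and> h x v = 0 \<longleftrightarrow> (\<exists>t. x = t *\<^sub>R w)" for x
  proof
    assume x: "x \<in> U \<and> h x v = 0"
    then obtain s t where st: "x = s *\<^sub>R v + t *\<^sub>R w'" using w'(4) in_span_pair by blast
    then have "s = 0" using x v(2) w'(3) by (simp add: form_simps)
    then have "x = (t / b) *\<^sub>R w" using st b by simp
    then show "\<exists>t. x = t *\<^sub>R w" by blast
  qed (use w sub in \<open>auto simp: form_simps subspace_scale\<close>)
  have "(\<exists>U'. geodesic_space h U' \<and> proj_set U = proj_set U' \<and> c *s v \<in> U' \<and> u \<in> U') \<longleftrightarrow> u \<in> (*s) c ` U" for u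
  proof
    assume "\<exists>U'. geodesic_space h U' \<and> proj_set U = proj_set U' \<and> c *s v \<in> U' \<and> u \<in> U'"
    then obtain U' where U': "geodesic_space h U'" "proj_set U = proj_set U'" "c *s v \<in> U'" "u \<in> U'"
      by blast
    have "U' \<subseteq> (*s) c ` U"
      using U' geodesic_space_scale[OF U c(1)] v c(1)
      by (intro geodesic_space_subset[where v = "c *s v"]) (auto simp: proj_set_scale form_simps)
    then show "u \<in> (*s) c ` U" using U'(4) by blast
  next
    assume "u \<in> (*s) c ` U"
    then show "\<exists>U'. geodesic_space h U' \<and> proj_set U = proj_set U' \<and> c *s v \<in> U' \<and> u \<in> U'"
      using geodesic_space_scale[OF U c(1)] v c(1)
      by (intro exI[of _ "(*s) c ` U"]) (auto simp: proj_set_scale)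
  qed
  then have "tangent_line h (proj v) (proj_set U) = {u. h u (c *s v) = 0 \<and> u \<in> (*s) c ` U}"
    by (simp add: tangent_line_def c(2))
  also have "\<dots> = (*s) c ` {x. x \<in> U \<and> h x v = 0}"
    using c(1) by (auto simp: form_simps)
  also have "\<dots> = range (\<lambda>b. (of_real b * c) *s w)"
  proof -
    have "{x. x \<in> U \<and> h x v = 0} = range (\<lambda>b. of_real b *s w)"
      unfolding perp by (auto simp: scaleR_eq_scale)
    then show ?thesis by (simp add: image_image mult.commute)
  qed
  finally show ?thesis .
qed

text \<open>The factor \<open>c\<close> between \<open>v\<close> and the chosen representative
  occurs in both tangent lines and cancels, so the angle can be read off from vectors orthogonal to
  \<open>v\<close>. The real factor \<open>r\<close> may be negative since tangent lines are
  unoriented.\<close>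

lemma angle_proj:
  assumes U: "geodesic_space h U1" "geodesic_space h U2" and v: "v \<in> U1" "v \<in> U2" "h v v \<noteq> 0"
    and w1: "w1 \<in> U1" "w1 \<noteq> 0" "h w1 v = 0" and w2: "w2 \<in> U2"
    and eq: "w2 = (of_real r * cis \<theta>) *s w1" "r \<noteq> 0" "0 \<le> \<theta>" "\<theta> < pi"
  shows "angle h (proj v) (proj_set U1) (proj_set U2) = \<theta>"
proof -
  have "v \<noteq> 0" using v(3) zero_left by auto
  then obtain c where c: "c \<noteq> 0" "rep (proj v) = c *s v" using rep_proj by blast
  have w2': "w2 \<noteq> 0" "h w2 v = 0" using eq w1 by (auto simp: form_simps)
  have t1: "tangent_line h (proj v) (proj_set U1) = range (\<lambda>b. (of_real b * c) *s w1)"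
    using tangent_line_proj U v w1 c by blast
  have t2: "tangent_line h (proj v) (proj_set U2) = range (\<lambda>b. (of_real b * c) *s w2)"
    using tangent_line_proj U v w2 w2' c by blast
  have "range (\<lambda>b. (of_real b * c) *s w2) = (*s) (cis \<theta>) ` range (\<lambda>b. (of_real b * c) *s w1)"
  proof (intro set_eqI iffI)
    fix x assume "x \<in> range (\<lambda>b. (of_real b * c) *s w2)"
    then obtain b where "x = (of_real b * c) *s w2" by blast
    then have "x = cis \<theta> *s ((of_real (b * r) * c) *s w1)" by (simp add: eq mult_ac)
    then show "x \<in> (*s) (cis \<theta>) ` range (\<lambda>b. (of_real b * c) *s w1)" by blast
  next
    fix x assume "x \<in> (*s) (cis \<theta>) ` range (\<lambda>b. (of_real b * c) *s w1)"
    then obtain b where "x = cis \<theta> *s ((of_real b * c) *s w1)" by blast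
    then have "x = (of_real (b / r) * c) *s w2" using eq(2) by (simp add: eq(1) mult_ac)
    then show "x \<in> range (\<lambda>b. (of_real b * c) *s w2)" by blast
  qed
  moreover have "\<phi> = \<theta>" if \<phi>: "0 \<le> \<phi>" "\<phi> < pi"
    "range (\<lambda>b. (of_real b * c) *s w2) = (*s) (cis \<phi>) ` range (\<lambda>b. (of_real b * c) *s w1)" for \<phi>
  proof -
    have "(of_real 1 * c) *s w2 \<in> range (\<lambda>b. (of_real b * c) *s w2)" by blast
    then obtain b where "c *s w2 = cis \<phi> *s ((of_real b * c) *s w1)" unfolding \<phi>(3) by (metis (no_types, lifting) image_iff mult_1 of_real_1)
    then have "(c * (of_real r * cis \<theta>)) *s w1 = (c * (of_real b * cis \<phi>)) *s w1"
      by (simp add: eq(1) mult_ac)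
    then have "of_real r * cis \<theta> = of_real b * cis \<phi>"
      using w1(2) c(1) by (simp add: vec.scale_right_imp_eq)
    then show ?thesis
      using real_cis_unique[of \<theta> \<phi> r b] eq \<phi> by simp
  qed
  ultimately show ?thesis
    unfolding angle_def t1 t2 using eq by (intro the_equality) blast+
qed

section \<open>The geodesic through two points\<close>

lemma geodesic_space_through:
  assumes v: "v \<noteq> 0" "w \<noteq> 0" and ne: "proj v \<noteq> proj w" "h v w \<noteq> 0"
  shows "geodesic_space h (span {v, h v w *s w})"
proof (rule geodesic_space_span[OF v(1)])
  show "h v w *s w \<noteq> c *s v" for c
  proof
    assume "h v w *s w = c *s v"
    then have "proj (h v w *s w) = proj v"
      using v ne(2) proj_eq_iff[of v "h v w *s w"] by (metis vec.scale_eq_0_iff)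
    then show False using ne v by (simp add: proj_scale)
  qed
  \<comment> \<open>The factor \<open>h v w\<close> is chosen so that the pairing with
    \<open>v\<close> becomes a positive real number.\<close>
  have "h v (h v w *s w) = of_real ((cmod (h v w))\<^sup>2)"
    unfolding complex_norm_square by (simp add: form_simps)
  then show "h v (h v w *s w) \<in> \<real>" "h v (h v w *s w) \<noteq> 0"
    using ne(2) by simp_all
qed

text \<open>Any plane through \<open>v\<close> for such a geodesic contains some
  \<open>c *s w\<close>. Reality of its pairing with \<open>v\<close> makes
  \<open>c * cnj (h v w)\<close> real, so \<open>c\<close> is a real multiple of
  \<open>h v w\<close>, and the plane is forced.\<close>

lemma geodesic_iff:
  assumes v: "v \<noteq> 0" "w \<noteq> 0" and ne: "proj v \<noteq> proj w" "h v w \<noteq> 0"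
  shows "geodesic h (cline (proj v) (proj w)) G \<and> proj v \<in> G \<and> proj w \<in> G \<longleftrightarrow>
    G = proj_set (span {v, h v w *s w})"
proof
  assume G: "geodesic h (cline (proj v) (proj w)) G \<and> proj v \<in> G \<and> proj w \<in> G"
  then obtain U where U: "geodesic_space h U" "G = proj_set U" "v \<in> U"
    using geodesic_obtain_space v by metis
  then have sub: "subspace U" and dim: "dim U = 2" by (auto simp: geodesic_space_def)
  obtain u where u: "u \<in> U" "u \<noteq> 0" "proj w = proj u" using G U(2) by (auto simp: proj_set_def)
  then obtain c where c: "u = c *s w" using proj_eq_iff v(2) by blast
  have "c \<noteq> 0" using c u by auto
  have "h u v \<in> \<real>" using U u(1) by (auto simp: geodesic_space_def)
  then obtain r where r: "h u v = of_real r" by (auto elim: Reals_cases)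
  have "cnj (h v w) * c = of_real r" using r commute[of v w] by (simp add: c form_simps mult.commute)
  then have "of_real ((cmod (h v w))\<^sup>2) * c = of_real r * h v w"
    unfolding complex_norm_square by (simp add: mult_ac del: of_real_power)
  then have "((cmod (h v w))\<^sup>2) *\<^sub>R u = r *\<^sub>R (h v w *s w)"
    by (simp add: c scaleR_eq_scale)
  moreover have "r \<noteq> 0"
    using r \<open>c \<noteq> 0\<close> ne(2) eq_0_commute[of v w] by (auto simp: c form_simps)
  moreover have "(1 / r) *\<^sub>R (r *\<^sub>R (h v w *s w)) = h v w *s w"
    using \<open>r \<noteq> 0\<close> by simp
  ultimately have "h v w *s w = ((cmod (h v w))\<^sup>2 / r) *\<^sub>R u"
    by (metis scaleR_scaleR times_divide_eq_left mult_1)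
  then have "h v w *s w \<in> U" using sub u(1) by (simp add: subspace_scale)
  then have "span {v, h v w *s w} \<subseteq> U" using U(3) sub by (intro span_minimal) auto
  moreover have "dim (span {v, h v w *s w}) = 2" using geodesic_space_through[OF assms] by (simp add: geodesic_space_def)
  ultimately have "span {v, h v w *s w} = U"
    using sub dim by (intro subspace_dim_equal) auto
  then show "G = proj_set (span {v, h v w *s w})" using U(2) by simp
next
  assume G: "G = proj_set (span {v, h v w *s w})"
  note geodesic_space_through[OF assms]
  moreover have "span {v, h v w *s w} \<subseteq> vec.span {v, w}"
  proof
    fix x assume "x \<in> span {v, h v w *s w}"
    then obtain a b where "x = of_real a *s v + (of_real b * h v w) *s w"
      by (auto simp: in_span_pair scaleR_eq_scale)
    moreover have "v \<in> vec.span {v, w}" "w \<in> vec.span {v, w}" by (auto intro: vec.span_base)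
    ultimately show "x \<in> vec.span {v, w}" by (simp add: vec.span_add vec.span_scale)
  qed
  then have "G \<subseteq> cline (proj v) (proj w)" unfolding cline_proj[OF v] G proj_set_def by blast
  moreover have "proj v \<in> G" unfolding G proj_set_def using v(1) by (auto intro: span_base)
  moreover have "proj (h v w *s w) \<in> G"
    unfolding G proj_set_def using v ne by (intro imageI) (auto intro: span_base)
  ultimately show "geodesic h (cline (proj v) (proj w)) G \<and> proj v \<in> G \<and> proj w \<in> G"
    using ne v unfolding geodesic_def by (auto simp: proj_scale G)
qed

lemma continuous_on_form_left: "continuous_on S (\<lambda>x. h x y)"
proof -
  have "linear (\<lambda>x. h x y)"
    by (rule linearI, rule add_left, subst scaleR_left, rule scaleR_conv_of_real[symmetric])
  then show ?thesis using linear_continuous_on linear_conv_bounded_linear by blast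
qed

lemma geodesic_through_eqI:
  assumes "p \<noteq> q" "\<not> orthog h p q" "geodesic h (cline p q) G" "p \<in> G" "q \<in> G"
  shows "geodesic_through h p q = G"
proof -
  obtain v where v: "v \<noteq> 0" "p = proj v" by (rule proj_cases)
  obtain w where w: "w \<noteq> 0" "q = proj w" by (rule proj_cases)
  have "h v w \<noteq> 0" "proj v \<noteq> proj w" using assms v w by (auto simp: orthog_proj)
  note * = geodesic_iff[OF v(1) w(1) this(2,1)]
  then show ?thesis
    unfolding geodesic_through_def using assms(3-5) v w by (intro the_equality) metis+
qed

lemma geodesic_through_proj:
  assumes "proj v \<noteq> proj w" "v \<noteq> 0" "w \<noteq> 0" "h v w \<noteq> 0"
  shows "geodesic_through h (proj v) (proj w) = proj_set (span {v, h v w *s w})"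
    and "geodesic_space h (span {v, h v w *s w})"
proof -
  note * = geodesic_iff[OF assms(2,3,1,4)]
  then have "geodesic h (cline (proj v) (proj w)) (proj_set (span {v, h v w *s w}))" 
    "proj v \<in> proj_set (span {v, h v w *s w})" "proj w \<in> proj_set (span {v, h v w *s w})"
    by blast+
  then show "geodesic_through h (proj v) (proj w) = proj_set (span {v, h v w *s w})"
    using assms by (intro geodesic_through_eqI) (auto simp: orthog_proj)
  show "geodesic_space h (span {v, h v w *s w})"
    using assms by (intro geodesic_space_through)
qed

lemma geodesic_through_commute: "geodesic_through h p q = geodesic_through h q p"
  by (simp add: geodesic_through_def cline_def insert_commute conj_commute conj_left_commute)

section \<open>Angles computed from values of the form\<close>

lemma orthogonal_expansion:
  assumes "v \<in> vec.span {u, u'}" "h u' u = 0" "h u u \<noteq> 0" "h u' u' \<noteq> 0"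
  shows "v = (h v u / h u u) *s u + (h v u' / h u' u') *s u'"
proof -
  obtain a b where "v = a *s u + b *s u'"
    using assms(1) by (auto simp: vec.span_breakdown_eq vec.span_singleton) (metis diff_add_cancel add.commute)
  moreover have "h u u' = 0" using assms(2) eq_0_commute by blast
  ultimately show ?thesis using assms by (simp add: form_simps)
qed

text \<open>The geodesic from \<open>u\<close> to \<open>v\<close> is tangent at \<open>u\<close> to
  the part of \<open>h u v *s v\<close> orthogonal to \<open>u\<close>, which is
  \<open>z / h u' u'\<close> times \<open>u'\<close>, where \<open>z = h u v * h v u'\<close>. As
  \<open>h u' u'\<close> is real, the angle is the argument of \<open>z\<close> modulo pi.
  Exchanging the two geodesics replaces \<open>z\<close> by its inverse, a positive multiple of
  \<open>cnj z\<close>.\<close>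

lemma angle_geodesic_through:
  assumes U: "geodesic_space h U" "u \<in> U" "u' \<in> U"
    and u: "h u' u = 0" "h u u \<noteq> 0" "h u' u' \<noteq> 0"
    and v: "v \<in> vec.span {u, u'}" "Im (h u v * h v u') \<noteq> 0"
  shows "angle h (proj u) (proj_set U) (geodesic_through h (proj u) (proj v)) = ang (h u v * h v u')"
    and "angle h (proj u) (geodesic_through h (proj u) (proj v)) (proj_set U) = ang (cnj (h u v * h v u'))"
proof -
  define z where "z = h u v * h v u'"
  have nz: "h u v \<noteq> 0" "h v u' \<noteq> 0" "z \<noteq> 0" using v(2) by (auto simp: z_def)
  have "v \<noteq> 0" "u \<noteq> 0" "u' \<noteq> 0" using nz u zero_left zero_right by auto
  have "proj u \<noteq> proj v"
  proof
    assume "proj u = proj v"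
    then obtain c where "v = c *s u" using proj_eq_iff[OF \<open>u \<noteq> 0\<close> \<open>v \<noteq> 0\<close>] by blast
    then show False using nz(2) u(1) eq_0_commute[of u u'] by (simp add: form_simps)
  qed
  note G = geodesic_through_proj[OF this \<open>u \<noteq> 0\<close> \<open>v \<noteq> 0\<close> nz(1)]
  let ?G = "span {u, h u v *s v}"
  define t where "t = Re (h u' u')"
  have t: "h u' u' = of_real t" unfolding t_def by (rule self_real)
  with u have "t \<noteq> 0" by auto
  obtain s where s: "h u u = of_real s" using self_real by blast
  define w where "w = (z / of_real t) *s u'"
  \<comment> \<open>The orthogonal part differs from \<open>h u v *s v\<close> by a multiple of
    \<open>u\<close> that is real, because \<open>h u v * h v u\<close> is a squared modulus. Hence
    it remains in the real plane \<open>?G\<close>.\<close>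
  have "w = - ((cmod (h u v))\<^sup>2 / s) *\<^sub>R u + h u v *s v"
  proof -
    have "h u v * h v u = of_real ((cmod (h u v))\<^sup>2)"
      unfolding complex_norm_square using commute[of v u] by simp
    moreover have "h u v *s v = (h u v * h v u / of_real s) *s u + w"
      unfolding w_def z_def using orthogonal_expansion[OF v(1) u]
      by (metis (no_types, lifting) s t times_divide_eq_right vec.scale_scale vec.scale_right_distrib)
    ultimately show ?thesis by (simp add: scaleR_eq_scale)
  qed
  then have w: "w \<in> ?G" using in_span_pair[of w u "h u v *s v"] by (metis scaleR_one)
  have uG: "u \<in> ?G" by (simp add: span_base)
  have "z = of_real (sgn (Im z) * cmod z) * cis (ang z)"
    using ang_polar(3)[of z] v(2) unfolding z_def[symmetric] by simp
  then have w1: "w = (of_real (sgn (Im z) * cmod z / t) * cis (ang z)) *s u'"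
    unfolding w_def by simp
  have "cnj z = of_real (sgn (Im (cnj z)) * cmod z) * cis (ang (cnj z))"
    using ang_polar(3)[of "cnj z"] v(2) unfolding z_def[symmetric] by simp
  moreover have "u' = (of_real (t / (cmod z)\<^sup>2) * cnj z) *s w"
  proof -
    have "of_real (t / (cmod z)\<^sup>2) * cnj z * (z / of_real t) = 1"
      using \<open>t \<noteq> 0\<close> nz(3) by (simp add: field_simps complex_norm_square del: of_real_power)
    then show ?thesis by (simp add: w_def)
  qed
  ultimately have w2: "u' = (of_real (t / (cmod z)\<^sup>2 * (sgn (Im (cnj z)) * cmod z)) * cis (ang (cnj z))) *s w"
    by (metis mult.assoc of_real_mult)
  have w0: "w \<noteq> 0" "h w u = 0"
    using nz \<open>u' \<noteq> 0\<close> \<open>t \<noteq> 0\<close> u by (auto simp: w_def form_simps)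
  have Imz: "Im z \<noteq> 0" "Im (cnj z) \<noteq> 0" using v(2) z_def by auto
  show "angle h (proj u) (proj_set U) (geodesic_through h (proj u) (proj v)) = ang (h u v * h v u')"
    unfolding G(1) z_def[symmetric]
  proof (rule angle_proj[OF U(1) G(2) U(2) uG u(2) U(3) \<open>u' \<noteq> 0\<close> u(1) w w1])
    show "sgn (Im z) * cmod z / t \<noteq> 0" using Imz \<open>t \<noteq> 0\<close> nz(3) by (simp add: sgn_if)
  qed (use ang_polar[OF Imz(1)] in simp_all)
  show "angle h (proj u) (geodesic_through h (proj u) (proj v)) (proj_set U) = ang (cnj (h u v * h v u'))"
    unfolding G(1) z_def[symmetric]
  proof (rule angle_proj[OF G(2) U(1) uG U(2) u(2) w w0 U(3) w2])
    show "t / (cmod z)\<^sup>2 * (sgn (Im (cnj z)) * cmod z) \<noteq> 0"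
      using Imz \<open>t \<noteq> 0\<close> nz(3) by (simp add: sgn_if)
  qed (use ang_polar[OF Imz(2)] in simp_all)
qed

text \<open>If the number is real, \<open>h u v *s v\<close> has real coordinates in the basis
  \<open>u\<close>, \<open>u'\<close>; if \<open>v\<close> is orthogonal to \<open>u\<close>, it is
  a multiple of \<open>u'\<close>. Used in contraposition: off the geodesic the angle is defined
  through a nonreal number.\<close>

lemma real_imp_in_geodesic:
  assumes U: "geodesic_space h U" "u \<in> U" "u' \<in> U"
    and u: "h u' u = 0" "h u u \<noteq> 0" "h u' u' \<noteq> 0"
    and v: "v \<in> vec.span {u, u'}" "v \<noteq> 0" and im: "Im (h u v * h v u') = 0"
  shows "proj v \<in> proj_set U"
proof (cases "h u v = 0")
  case True
  then have "h v u = 0" using eq_0_commute by blast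
  then have v': "v = (h v u' / h u' u') *s u'"
    using orthogonal_expansion[OF v(1) u] by simp
  then have "h v u' / h u' u' \<noteq> 0" using v(2) by (metis vec.scale_zero_left)
  moreover have "u' \<noteq> 0" using u(3) zero_left by auto
  ultimately have "proj v = proj u'" using v' proj_scale by metis
  then show ?thesis using U(3) \<open>u' \<noteq> 0\<close> by (auto simp: proj_set_def)
next
  case False
  have sub: "subspace U" using U(1) by (simp add: geodesic_space_def)
  obtain s t where st: "h u u = of_real s" "h u' u' = of_real t" using self_real by metis
  have "h u v * h v u = of_real ((cmod (h u v))\<^sup>2)"
    unfolding complex_norm_square using commute[of v u] by simp
  moreover have "h u v * h v u' = of_real (Re (h u v * h v u'))"
    using im by (simp add: complex_eq_iff)
  ultimately have "h u v *s v = ((cmod (h u v))\<^sup>2 / s) *\<^sub>R u + (Re (h u v * h v u') / t) *\<^sub>R u'"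
    using orthogonal_expansion[OF v(1) u] unfolding scaleR_eq_scale
    by (metis (no_types, lifting) st of_real_divide times_divide_eq_right vec.scale_scale vec.scale_right_distrib)
  then have "h u v *s v \<in> U" using sub U by (simp add: subspace_add subspace_scale)
  then have "proj (h u v *s v) \<in> proj_set U"
    using False v(2) by (auto simp: proj_set_def)
  then show ?thesis using False v(2) by (simp add: proj_scale)
qed

section \<open>Arcs as segments in an affine chart\<close>

lemma geodesic_point:
  assumes "x \<in> proj_set (span {p, w})" "\<not> orthog h x (proj p)" "h w p = 0" "p \<noteq> 0"
  obtains b where "x = proj (p + b *\<^sub>R w)" "p + b *\<^sub>R w \<noteq> 0"
proof -
  obtain v where v: "v \<in> span {p, w}" "v \<noteq> 0" "x = proj v" using assms(1) by (auto simp: proj_set_def)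
  obtain a c where ac: "v = a *\<^sub>R p + c *\<^sub>R w" using v(1) in_span_pair by blast
  have "h v p \<noteq> 0" using assms(2,4) v(2,3) orthog_proj by metis
  then have "a \<noteq> 0" using ac assms(3) by (auto simp: form_simps)
  then have eq: "v = of_real a *s (p + (c / a) *\<^sub>R w)"
    using ac unfolding scaleR_eq_scale[symmetric] by (simp add: algebra_simps)
  then have nz: "p + (c / a) *\<^sub>R w \<noteq> 0" using v(2) by (metis vec.scale_zero_right)
  then have "x = proj (p + (c / a) *\<^sub>R w)"
    using v(3) eq \<open>a \<noteq> 0\<close> proj_scale by (metis of_real_eq_0_iff)
  then show thesis using that nz by blast
qed

text \<open>Removing the point orthogonal to \<open>p\<close> turns the geodesic into a real affine
  line with coordinate \<open>coord\<close>. An admissible arc then becomes an injective real path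
  from 0 to \<open>b\<close>, whose image can only be the segment between them.\<close>

lemma geodesic_arc_segment:
  assumes U: "geodesic_space h (span {p, w})"
    and h: "h w p = 0" "h p p \<noteq> 0" "h w w \<noteq> 0"
  shows "geodesic_arc h (proj p) (proj (p + b *\<^sub>R w)) = (\<lambda>t. proj (p + (t * b) *\<^sub>R w)) ` {0..1}"
proof (cases "b = 0")
  case False
  have hpw: "h p w = 0" using h(1) eq_0_commute[of p w] by simp
  have nz: "p \<noteq> 0" "w \<noteq> 0" using h(2,3) by (auto simp: zero_left)
  let ?U = "span {p, w}"
  let ?c = "\<lambda>s::real. p + s *\<^sub>R w"
  have hc: "h (?c s) p = h p p" "h (?c s) w = of_real s * h w w" for s
    using h hpw by (simp_all add: form_simps)
  have cnz: "?c s \<noteq> 0" for s using hc(1)[of s] h(2) zero_left by metis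
  have c_inj: "s = s'" if eq: "proj (?c s) = proj (?c s')" for s s'
  proof -
    obtain k where k: "?c s' = k *s ?c s" using eq proj_eq_iff[OF cnz cnz] by blast
    then have "h p p = k * h p p" using hc(1) by (metis scale_left)
    then have "k = 1" using h(2) by (metis mult_cancel_right1)
    then show ?thesis using k nz(2) by simp
  qed
  have cU: "?c s \<in> ?U" for s by (intro span_add span_scale span_base) auto
  have ne: "proj p \<noteq> proj (?c b)" using c_inj[of 0 b] False by auto
  have "proj_set ?U \<subseteq> cline (proj p) (proj (?c b))"
  proof -
    have "?U \<subseteq> vec.span {p, ?c b}"
    proof
      fix x assume "x \<in> ?U"
      then obtain a c where ac: "x = a *\<^sub>R p + c *\<^sub>R w" using in_span_pair by blast
      then have "x = (a - c / b) *\<^sub>R p + (c / b) *\<^sub>R ?c b"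
        using False by (simp add: algebra_simps)
      moreover have "p \<in> vec.span {p, ?c b}" "?c b \<in> vec.span {p, ?c b}" by (simp_all add: vec.span_base)
      ultimately show "x \<in> vec.span {p, ?c b}"
        by (metis scaleR_eq_scale vec.span_add vec.span_scale)
    qed
    then show ?thesis using cline_proj[OF nz(1) cnz] by (auto simp: proj_set_def)
  qed
  then have through: "geodesic_through h (proj p) (proj (?c b)) = proj_set ?U"
    using ne nz(1) cnz[of b] U cU[of b] cU[of 0] h hpw
    by (intro geodesic_through_eqI) (auto simp: geodesic_def orthog_proj form_simps proj_set_def)
  \<comment> \<open>The quotient is unchanged when the representative is rescaled, and the constant
    factor normalises it to give \<open>s\<close> at \<open>p + s *\<^sub>R w\<close>.\<close>
  define coord where "coord x = Re (h (rep x) w / h (rep x) p * (h p p / h w w))" for x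
  have coord_proj: "coord (proj v) = Re (h v w / h v p * (h p p / h w w))" if v: "v \<noteq> 0" for v
  proof -
    obtain k where "k \<noteq> 0" "rep (proj v) = k *s v" using rep_proj[OF v] by blast
    then show ?thesis by (simp add: coord_def form_simps)
  qed
  have coord_c: "coord (proj (?c s)) = s" for s
    using coord_proj[OF cnz] h hc by simp
  define S where "S = {x. \<not> orthog h x (proj p)}"
  have S: "v \<noteq> 0 \<and> proj v \<in> S \<longleftrightarrow> h v p \<noteq> 0" for v
    using nz(1) orthog_proj[of v p] zero_left[of p] by (cases "v = 0") (auto simp: S_def)
  have "continuous_on S coord"
  proof (rule continuous_on_cp2)
    have "{v. h v p \<noteq> 0} = - {v. h v p = 0}" by auto
    moreover have "closed {v. h v p = 0}"
      by (intro closed_Collect_eq continuous_on_form_left continuous_on_const)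
    ultimately show "open {v. v \<noteq> 0 \<and> proj v \<in> S}" unfolding S by (metis open_Compl)
    have "continuous_on {v. h v p \<noteq> 0} (\<lambda>v. Re (h v w / h v p * (h p p / h w w)))"
      using h(3) by (intro continuous_intros continuous_on_form_left) auto
    then show "continuous_on {v. v \<noteq> 0 \<and> proj v \<in> S} (\<lambda>v. coord (proj v))"
      unfolding S by (rule continuous_on_eq) (auto simp: coord_proj S[symmetric])
  qed
  have param: "x = proj (?c (coord x))" if x: "x \<in> proj_set ?U" "x \<in> S" for x
  proof -
    have "\<not> orthog h x (proj p)" using x(2) by (simp add: S_def)
    then obtain c where "x = proj (?c c)" using geodesic_point[OF x(1) _ h(1) nz(1)] by blast
    then show ?thesis using coord_c by simp
  qed
  let ?g = "\<lambda>t. proj (?c (t * b))"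
  have cont: "continuous_on {0..1} ?g"
    by (intro continuous_on_proj continuous_intros cnz)
  have g: "arc ?g" "pathstart ?g = proj p" "pathfinish ?g = proj (?c b)"
    using cont c_inj False by (auto simp: arc_def path_def pathstart_def pathfinish_def inj_on_def dest: c_inj)
  have "?g ` {0..1} \<subseteq> proj_set ?U" using cU cnz by (auto simp: proj_set_def)
  moreover have "\<forall>x\<in>?g ` {0..1}. \<not> orthog h x (proj p)"
    using nz(1) cnz hc(1) h(2) by (auto simp: orthog_proj)
  ultimately have ex: "\<exists>g. arc g \<and> pathstart g = proj p \<and> pathfinish g = proj (?c b) \<and> ?g ` {0..1} = path_image g \<and>
      ?g ` {0..1} \<subseteq> proj_set ?U \<and> (\<forall>x\<in>?g ` {0..1}. \<not> orthog h x (proj p))"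
    using g by (intro exI[of _ ?g]) (auto simp: path_image_def)
  have seg: "(\<lambda>t. t * b) ` {0..1} = closed_segment 0 b"
    by (auto simp: closed_segment_def image_def)
  \<comment> \<open>The definite description needs every admissible arc to have the same image, not
    merely the same endpoints.\<close>
  have un: "path_image g = ?g ` {0..1}"
    if g: "arc g" "pathstart g = proj p" "pathfinish g = proj (?c b)"
      and im: "path_image g \<subseteq> proj_set ?U" "\<forall>x\<in>path_image g. \<not> orthog h x (proj p)" for g
  proof -
    have gU: "g t \<in> proj_set ?U" "g t \<in> S" if "t \<in> {0..1}" for t
      using that im by (auto simp: path_image_def S_def)
    define \<phi> where "\<phi> = coord \<circ> g"
    have \<phi>: "\<phi> 0 = 0" "\<phi> 1 = b"
      using g(2,3) coord_c[of 0] coord_c[of b] by (auto simp: \<phi>_def pathstart_def pathfinish_def)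
    have "continuous_on {0..1} g" "inj_on g {0..1}" using g(1) by (simp_all add: arc_def path_def)
    moreover have "g ` {0..1} \<subseteq> S" using gU(2) by blast
    ultimately have c\<phi>: "continuous_on {0..1} \<phi>"
      unfolding \<phi>_def
      using continuous_on_compose continuous_on_subset[OF \<open>continuous_on S coord\<close>] by blast
    have i\<phi>: "inj_on \<phi> {0..1}"
    proof (rule inj_onI)
      fix s t :: real
      assume st: "s \<in> {0..1}" "t \<in> {0..1}" and "\<phi> s = \<phi> t"
      then have "coord (g s) = coord (g t)" by (simp add: \<phi>_def)
      then have "g s = g t" using param[OF gU[OF st(1)]] param[OF gU[OF st(2)]] by metis
      then show "s = t" using inj_onD[OF \<open>inj_on g {0..1}\<close>] st by blast
    qed
    \<comment> \<open>Injectivity makes the real path monotone, which keeps it between its end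
      values; connectedness of the image gives the other inclusion.\<close>
    have "\<phi> ` {0..1} = closed_segment 0 b"
    proof
      show "\<phi> ` {0..1} \<subseteq> closed_segment 0 b"
      proof clarify
        fix t :: real assume t: "t \<in> {0..1}"
        show "\<phi> t \<in> closed_segment 0 b"
        proof (cases "t = 0 \<or> t = 1")
          case False
          then show ?thesis
            using continuous_inj_imp_mono[OF _ _ c\<phi> i\<phi>, of t] t \<phi>
            by (auto simp: closed_segment_eq_real_ivl)
        qed (use \<phi> in auto)
      qed
      have "connected (\<phi> ` {0..1})" by (rule connected_continuous_image[OF c\<phi> connected_Icc])
      then have "convex (\<phi> ` {0..1})" by (simp only: connected_convex_1)
      moreover have "0 \<in> \<phi> ` {0..1}" "b \<in> \<phi> ` {0..1}"
        using \<phi> imageI[of 0 "{0..1}" \<phi>] imageI[of 1 "{0..1}" \<phi>] by simp_all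
      ultimately show "closed_segment 0 b \<subseteq> \<phi> ` {0..1}"
        by (intro closed_segment_subset)
    qed
    then have "(\<lambda>s. proj (?c s)) ` \<phi> ` {0..1} = (\<lambda>s. proj (?c s)) ` (\<lambda>t. t * b) ` {0..1}"
      using seg by simp
    moreover have "(\<lambda>s. proj (?c s)) ` \<phi> ` {0..1} = g ` {0..1}"
      unfolding image_image using param gU by (intro image_cong) (auto simp: \<phi>_def)
    ultimately show ?thesis by (simp add: path_image_def image_image)
  qed
  have "(THE A. \<exists>g. arc g \<and> pathstart g = proj p \<and> pathfinish g = proj (?c b) \<and> A = path_image g \<and>
      A \<subseteq> proj_set ?U \<and> (\<forall>x\<in>A. \<not> orthog h x (proj p))) = ?g ` {0..1}"
  proof (rule the_equality)
    fix A
    assume "\<exists>g. arc g \<and> pathstart g = proj p \<and> pathfinish g = proj (?c b) \<and> A = path_image g \<and>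
      A \<subseteq> proj_set ?U \<and> (\<forall>x\<in>A. \<not> orthog h x (proj p))"
    then show "A = ?g ` {0..1}" using un by metis
  qed (rule ex)
  then show ?thesis
    unfolding geodesic_arc_def through using ne by (simp only: if_False)
qed (auto simp: geodesic_arc_def image_constant_conv)

end

section \<open>Parameters\<close>

lemma cis_eq_imp_eq:
  assumes "cis a = cis b" "\<bar>a - b\<bar> < 2 * pi"
  shows "a = b"
proof -
  have "cis (a - b) = 1" using assms(1) by (simp add: cis_divide[symmetric])
  then have "cos (a - b) = 1" by (simp add: complex_eq_iff)
  then obtain n where n: "a - b = real_of_int n * 2 * pi" using cos_one_2pi_int by blast
  then have "\<bar>real_of_int n\<bar> < 1" using assms(2) by (simp add: abs_mult)
  then have "n = 0" by linarith
  then show ?thesis using n by simp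
qed

lemma omega_power: "omega ^ j = cis (real j * (2 * pi / 3))"
  by (simp add: omega_def Complex.DeMoivre)

text \<open>Cubing removes the power of \<open>omega\<close>; this is why a primitive does not see
  the component of its parameter.\<close>

lemma cube_omega: "(omega ^ j * cis \<theta>) ^ 3 = cis (3 * \<theta>)"
proof -
  have "omega ^ 3 = 1" by (simp add: omega_def Complex.DeMoivre)
  then have "(omega ^ j) ^ 3 = 1" by (metis power_mult mult.commute power_one)
  then show ?thesis by (simp add: power_mult_distrib Complex.DeMoivre)
qed

text \<open>The excluded values have cube 1, while \<open>3 * \<theta>\<close> lies strictly between
  0 and a full turn.\<close>

lemma is_parameter_arc:
  assumes "0 < \<theta>" "\<theta> < 2 * pi / 3"
  shows "is_parameter (omega ^ j * cis \<theta>)"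
proof -
  have "cis (3 * \<theta>) \<noteq> 1"
    using cis_eq_imp_eq[of "3 * \<theta>" 0] assms by auto
  moreover have "x ^ 3 = 1" if "x \<in> {1, omega, omega\<^sup>2}" for x
    using that cube_omega[of 1 0] cube_omega[of 2 0] by auto
  moreover have "norm (omega ^ j * cis \<theta>) = 1" by (simp add: omega_power norm_mult)
  ultimately show ?thesis unfolding is_parameter_def using cube_omega by metis
qed

text \<open>For a candidate \<open>cis \<psi>\<close> both \<open>6 * \<psi>\<close> and
  \<open>3 * \<theta>\<close> lie strictly between 0 and \<open>2 * pi\<close>, so comparing sixth
  power and cube determines \<open>\<psi>\<close>.\<close>

lemma primitive_arc:
  assumes "0 < \<theta>" "\<theta> < 2 * pi / 3"
  shows "primitive (omega ^ j * cis \<theta>) = cis (\<theta> / 2)"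
  unfolding primitive_def cube_omega
proof (rule the_equality)
  show "cis (\<theta> / 2) \<in> J_arc \<and> cis (\<theta> / 2) ^ 6 = cis (3 * \<theta>)"
    using assms by (auto simp: J_arc_def Complex.DeMoivre)
next
  fix a assume a: "a \<in> J_arc \<and> a ^ 6 = cis (3 * \<theta>)"
  then obtain \<psi> where \<psi>: "a = cis \<psi>" "0 < \<psi>" "\<psi> < pi / 3" by (auto simp: J_arc_def)
  then have "cis (6 * \<psi>) = cis (3 * \<theta>)" using a by (simp add: Complex.DeMoivre)
  then have "6 * \<psi> = 3 * \<theta>" using cis_eq_imp_eq[of "6 * \<psi>" "3 * \<theta>"] \<psi> assms by auto
  then have "\<psi> = \<theta> / 2" by simp
  then show "a = cis (\<theta> / 2)" using \<psi>(1) by (simp only:)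
qed

text \<open>Together with \<open>primitive_arc\<close> this makes the prescribed angle 3/2 times the
  argument inside the component. Within fixed components, the product of two parameters is therefore
  governed by the sum of the two angles.\<close>

lemma Arg2pi_cis_cube:
  assumes "0 < \<theta>" "\<theta> < 2 * pi / 3"
  shows "Arg2pi (cis (\<theta> / 2) ^ 3) = 3 * \<theta> / 2"
proof -
  have "cis (\<theta> / 2) ^ 3 = cis (3 * \<theta> / 2)" by (simp add: Complex.DeMoivre)
  then show ?thesis using assms by (intro Arg2pi_unique[of 1]) (simp_all add: cis_conv_exp)
qed

lemma same_componentE:
  assumes "same_component \<alpha> \<beta>"
  obtains j \<theta> \<phi> where "j \<in> {0, 1, 2}" "\<alpha> = omega ^ j * cis \<theta>" "0 < \<theta>" "\<theta> < 2 * pi / 3"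
    "\<beta> = omega ^ j * cis \<phi>" "0 < \<phi>" "\<phi> < 2 * pi / 3"
  using assms unfolding same_component_def I_arc_def by blast

lemma same_componentI:
  assumes "j \<in> {0, 1, 2}" "0 < \<theta>" "\<theta> < 2 * pi / 3" "0 < \<phi>" "\<phi> < 2 * pi / 3"
  shows "same_component (omega ^ j * cis \<theta>) (omega ^ j * cis \<phi>)"
  using assms unfolding same_component_def I_arc_def by blast


section \<open>Level curves of the angle sum\<close>

lemma sgn_eq_cis_ang:
  assumes "Im z \<noteq> 0"
  shows "sgn z = of_real (sgn (Im z)) * cis (ang z)"
proof -
  have "z \<noteq> 0" using assms by auto
  then have "sgn z = (z / of_real (cmod z))"
    by (simp add: sgn_div_norm scaleR_conv_of_real field_simps)
  also have "\<dots> = of_real (sgn (Im z)) * cis (ang z)"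
    using ang_polar(3)[OF assms] \<open>z \<noteq> 0\<close> by (simp add: field_simps)
  finally show ?thesis .
qed

lemma sgn_constant_on:
  fixes g :: "'a :: topological_space \<Rightarrow> real"
  assumes "connected S" "continuous_on S g" "\<And>x. x \<in> S \<Longrightarrow> g x \<noteq> 0" "x \<in> S" "y \<in> S"
  shows "sgn (g x) = sgn (g y)"
proof -
  have "connected (g ` S)" using assms connected_continuous_image by blast
  then have conv: "c \<in> g ` S" if "a \<in> g ` S" "b \<in> g ` S" "a \<le> c" "c \<le> b" for a b c
    using that connected_contains_Icc[of "g ` S" a b] by auto
  have "0 \<notin> g ` S" using assms(3) by auto
  then have "\<not> (g x < 0 \<and> 0 < g y)" "\<not> (g y < 0 \<and> 0 < g x)"
    using conv[of "g x" "g y" 0] conv[of "g y" "g x" 0] assms(4,5) by auto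
  then show ?thesis using assms(3)[OF assms(4)] assms(3)[OF assms(5)] by (auto simp: sgn_if)
qed

text \<open>On a connected set the imaginary part keeps one sign \<open>e\<close>. Then
  \<open>ang\<close> is the principal argument of \<open>e\<close> times the function, which stays
  in the upper half-plane and away from the branch cut.\<close>

lemma continuous_on_ang:
  fixes A :: "'a :: topological_space \<Rightarrow> complex"
  assumes S: "connected S" and A: "continuous_on S A" "\<And>x. x \<in> S \<Longrightarrow> Im (A x) \<noteq> 0"
  shows "continuous_on S (\<lambda>x. ang (A x))"
proof (cases "S = {}")
  case False
  then obtain x0 where x0: "x0 \<in> S" by blast
  define e where "e = sgn (Im (A x0))"
  have "continuous_on S (\<lambda>x. Im (A x))" using A(1) by (rule continuous_on_Im)
  then have e: "sgn (Im (A x)) = e" if "x \<in> S" for x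
    unfolding e_def using sgn_constant_on[of S "\<lambda>x. Im (A x)"] S A(2) that x0 by blast
  have pos: "Im (of_real e * A x) > 0" "ang (A x) = Arg (of_real e * A x)" if "x \<in> S" for x
    using A(2)[OF that] by (simp_all add: e[OF that, symmetric] ang_def sgn_if)
  have "of_real e * A x \<notin> \<real>\<^sub>\<le>\<^sub>0" if "x \<in> S" for x
    using pos(1)[OF that] by (metis complex_nonpos_Reals_iff less_irrefl)
  then have "continuous_on S (\<lambda>x. Arg (of_real e * A x))"
    using A(1) by (intro continuous_on_Arg' continuous_intros)
  then show ?thesis by (rule continuous_on_eq) (simp add: pos(2))
qed simp

text \<open>Collects what the geometry has to supply. The assumption \<open>prod\<close> ties the
  angle sum to twice the argument of \<open>f\<close>; \<open>edge\<close> compares the turning of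
  \<open>f\<close> along the two vertical edges of the square, which decides the signs of the
  coefficients of the hyperbola.\<close>

lemma angle_sum_level_curve:
  fixes f A B :: "real \<Rightarrow> real \<Rightarrow> complex"
  defines "Q \<equiv> {0..1::real} \<times> {0..1::real}"
  assumes biaffine: "\<And>x y. f x y = f 0 0 + of_real x * (f 1 0 - f 0 0) + of_real y * (f 0 1 - f 0 0)
      + of_real (x * y) * (f 1 1 - f 1 0 - f 0 1 + f 0 0)"
    and cont: "continuous_on Q (\<lambda>(x, y). A x y)" "continuous_on Q (\<lambda>(x, y). B x y)"
    and Im: "\<And>x y. (x, y) \<in> Q \<Longrightarrow> Im (A x y) \<noteq> 0" "\<And>x y. (x, y) \<in> Q \<Longrightarrow> Im (B x y) \<noteq> 0"
    and prod: "\<And>x y. (x, y) \<in> Q \<Longrightarrow> A x y * B x y = k * of_real (\<rho> x y) * (f x y)\<^sup>2"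
      "\<And>x y. (x, y) \<in> Q \<Longrightarrow> \<rho> x y > 0"
    and edge: "\<And>x. x \<in> {0..1} \<Longrightarrow> Im (f x 1 * cnj (f x 0)) = m * Im (B x 0)"
    and ends: "ang (A 0 0) + ang (B 0 0) = ang (A 1 1) + ang (B 1 1)"
  obtains Y where "continuous_on {0..1} Y" "Y 0 = 0" "Y 1 = 1" "\<And>x. x \<in> {0..1} \<Longrightarrow> Y x \<in> {0..1}"
    "\<And>x. x \<in> {0..1} \<Longrightarrow> ang (A x (Y x)) + ang (B x (Y x)) = ang (A 0 0) + ang (B 0 0)"
proof -
  let ?S = "\<lambda>x y. ang (A x y) + ang (B x y)"
  have "convex Q" by (simp add: Q_def convex_Times)
  then have Q: "connected Q" by (rule convex_connected)
  have q: "(0, 0) \<in> Q" "(1, 1) \<in> Q" "(0, 1) \<in> Q" "(1, 0) \<in> Q" by (auto simp: Q_def)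
  have f0: "f x y \<noteq> 0" if "(x, y) \<in> Q" for x y
    using prod(1)[OF that] Im[OF that] by auto
  have sA: "sgn (Im (A x y)) = sgn (Im (A 0 0))" if "(x, y) \<in> Q" for x y
    using sgn_constant_on[OF Q, of "\<lambda>z. Im (case z of (x, y) \<Rightarrow> A x y)" "(x, y)" "(0, 0)"] that q Im cont
    by (auto intro: continuous_on_Im)
  have sB: "sgn (Im (B x y)) = sgn (Im (B 0 0))" if "(x, y) \<in> Q" for x y
    using sgn_constant_on[OF Q, of "\<lambda>z. Im (case z of (x, y) \<Rightarrow> B x y)" "(x, y)" "(0, 0)"] that q Im cont
    by (auto intro: continuous_on_Im)
  \<comment> \<open>\<open>ang\<close> is an argument only up to sign of the number. The sign
    \<open>e\<close> accounts for both factors at once and is constant on the square, so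
    \<open>cis\<close> of the angle sum is a constant \<open>K\<close> times the square of
    \<open>sgn f\<close>.\<close>
  define e where "e = sgn (Im (A 0 0)) * sgn (Im (B 0 0))"
  have e: "e * e = 1" using Im q by (auto simp: e_def sgn_if)
  define K where "K = of_real e * sgn k"
  have cisS: "cis (?S x y) = K * (sgn (f x y))\<^sup>2" if xy: "(x, y) \<in> Q" for x y
  proof -
    have "sgn (A x y) * sgn (B x y) = sgn k * (sgn (f x y))\<^sup>2"
      using arg_cong[OF prod(1)[OF xy], of sgn] prod(2)[OF xy]
      by (simp add: sgn_mult power2_eq_square sgn_of_real)
    moreover have "sgn (A x y) * sgn (B x y) = of_real e * cis (?S x y)"
      unfolding sgn_eq_cis_ang[OF Im(1)[OF xy]] sgn_eq_cis_ang[OF Im(2)[OF xy]] sA[OF xy] sB[OF xy] e_def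
      by (simp add: cis_mult[symmetric])
    ultimately have "of_real e * (of_real e * cis (?S x y)) = K * (sgn (f x y))\<^sup>2"
      by (simp add: K_def)
    then show ?thesis using e by (simp flip: mult.assoc of_real_mult)
  qed
  have range: "0 < ?S x y" "?S x y < 2 * pi" if "(x, y) \<in> Q" for x y
    using ang_polar[OF Im(1)[OF that]] ang_polar[OF Im(2)[OF that]] by auto
  \<comment> \<open>A real factor between \<open>f x y\<close> and \<open>f 0 0\<close> disappears
    in the square of \<open>sgn\<close>, so \<open>cis\<close> of the angle sum agrees at both
    points. Since the sum stays strictly between 0 and \<open>2 * pi\<close>, the sum itself
    agrees.\<close>
  have level: "?S x y = ?S 0 0" if xy: "(x, y) \<in> Q" and re: "Im (f x y * cnj (f 0 0)) = 0" for x y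
  proof -
    define s where "s = Re (f x y * cnj (f 0 0)) / (cmod (f 0 0))\<^sup>2"
    have "f x y * cnj (f 0 0) = of_real (Re (f x y * cnj (f 0 0)))" using re by (simp add: complex_eq_iff)
    then have "f x y * (f 0 0 * cnj (f 0 0)) = of_real (Re (f x y * cnj (f 0 0))) * f 0 0"
      by (metis mult.assoc mult.commute)
    then have s: "f x y = of_real s * f 0 0"
      using f0[OF q(1)] unfolding s_def complex_norm_square[symmetric]
      by (simp add: field_simps del: of_real_power)
    then have "s \<noteq> 0" using f0[OF xy] by auto
    then have "(sgn (f x y))\<^sup>2 = (sgn (f 0 0))\<^sup>2"
      by (simp add: s sgn_mult power_mult_distrib sgn_of_real) (auto simp: sgn_if)
    then have "cis (?S x y) = cis (?S 0 0)" using cisS xy q(1) by metis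
    then show ?thesis using cis_eq_imp_eq range[OF xy] range[OF q(1)] by fastforce
  qed
  \<comment> \<open>Along the diagonal, cis (S / 2) / sgn f is a continuous square root of a constant.\<close>
  have pos: "sgn (f 1 1) = sgn (f 0 0)"
  proof -
    define M where "M t = cis (?S t t / 2) / sgn (f t t)" for t
    have diag: "(t, t) \<in> Q" if "t \<in> {0..1}" for t using that by (auto simp: Q_def)
    have cd: "continuous_on {0..1} (\<lambda>t. A t t)" "continuous_on {0..1} (\<lambda>t. B t t)"
      using continuous_on_compose2[OF cont(1), of "{0..1}" "\<lambda>t. (t, t)"]
        continuous_on_compose2[OF cont(2), of "{0..1}" "\<lambda>t. (t, t)"] diag
      by (simp_all add: image_subset_iff continuous_on_Pair continuous_on_id)
    have "continuous_on {0..1} (\<lambda>t. f t t)"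
      by (subst biaffine) (intro continuous_intros)
    then have "continuous_on {0..1} M"
      unfolding M_def sgn_div_norm using f0 diag
      by (intro continuous_intros continuous_on_ang cd Im) auto
    have M2: "(M t)\<^sup>2 = K" if "t \<in> {0..1}" for t
    proof -
      have "(cis (?S t t / 2))\<^sup>2 = cis (?S t t)" 
        by (simp only: Complex.DeMoivre of_nat_numeral mult_2 field_sum_of_halves)
      then show ?thesis
        using cisS[OF diag[OF that]] f0[OF diag[OF that]] by (simp add: M_def power_divide sgn_zero_iff)
    qed
    have "K \<noteq> 0" using cisS[OF q(1)] by auto
    then have M0: "M t \<noteq> 0" if "t \<in> {0..1}" for t using M2[OF that] by auto
    have pm: "M t / M 0 = 1 \<or> M t / M 0 = - 1" if "t \<in> {0..1}" for t
      using M2[OF that] M2[of 0] M0[of 0] by (auto simp: power2_eq_iff field_simps)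
    \<comment> \<open>The ratio takes only the values 1 and -1 and starts at 1, so by continuity it
      never changes. This excludes \<open>sgn (f 1 1) = - sgn (f 0 0)\<close>, which the squares
      alone cannot do.\<close>
    have "sgn (Re (M 1 / M 0)) = sgn (Re (M 0 / M 0))"
    proof (rule sgn_constant_on[where g = "\<lambda>t. Re (M t / M 0)" and S = "{0..1}"])
      show "continuous_on {0..1} (\<lambda>t. Re (M t / M 0))"
        using \<open>continuous_on {0..1} M\<close> M0[of 0] by (intro continuous_intros) auto
      show "Re (M t / M 0) \<noteq> 0" if "t \<in> {0..1}" for t using pm[OF that] by auto
    qed auto
    then have "M 1 = M 0" using pm[of 1] M0[of 0] by auto
    then show ?thesis using ends f0 q by (simp add: M_def sgn_zero_iff)
  qed
  define r where "r = cmod (f 1 1) / cmod (f 0 0)"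
  have r: "r > 0" "f 1 1 = of_real r * f 0 0"
  proof -
    show "r > 0" using f0 q by (simp add: r_def)
    have "f 1 1 = of_real (cmod (f 1 1)) * sgn (f 1 1)" "f 0 0 = of_real (cmod (f 0 0)) * sgn (f 0 0)"
      using f0 q by (simp_all add: sgn_div_norm scaleR_conv_of_real)
    then show "f 1 1 = of_real r * f 0 0"
      unfolding r_def pos by (metis (no_types, opaque_lifting) f0 q(1) mult.assoc nonzero_eq_divide_eq norm_eq_zero of_real_divide of_real_eq_0_iff)
  qed
  define a where "a = Im (f 1 0 * cnj (f 0 0))"
  define b where "b = Im (f 0 1 * cnj (f 0 0))"
  \<comment> \<open>A real biaffine function of \<open>x\<close> and \<open>y\<close> that vanishes
    at the corners (0, 0) and (1, 1) is determined by its values \<open>a\<close> and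
    \<open>b\<close> at the two other corners.\<close>
  have fim: "Im (f x y * cnj (f 0 0)) = a * x * (1 - y) + b * y * (1 - x)" for x y
    using r(2) by (subst biaffine) (simp add: a_def b_def algebra_simps)
  \<comment> \<open>\<open>edge\<close> at \<open>x = 0\<close> yields \<open>b\<close>, and at
    \<open>x = 1\<close>, where \<open>f 1 1\<close> is a positive multiple of \<open>f 0 0\<close>,
    it yields a positive multiple of \<open>- a\<close>. Both have the sign of \<open>m\<close>
    times the constant sign of \<open>Im B\<close>.\<close>
  have "sgn b = sgn m * sgn (Im (B 0 0))" using edge[of 0] by (simp add: b_def sgn_mult)
  moreover have "Im (f 1 1 * cnj (f 1 0)) = r * - a"
    unfolding r(2) a_def by (simp add: algebra_simps)
  then have "sgn (- a) = sgn m * sgn (Im (B 0 0))"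
    using edge[of 1] r(1) sB[OF q(4)] by (metis atLeastAtMost_iff le_numeral_extra(4) mult_1 sgn_mult sgn_pos zero_le_one)
  ultimately have ab: "sgn b = - sgn a" by simp
  show thesis
  proof (cases "a = 0")
    \<comment> \<open>With \<open>a = b = 0\<close> the values of \<open>f\<close> on the square are
      all real multiples of \<open>f 0 0\<close>, and the diagonal serves as the curve.\<close>
    case True
    then have "b = 0" using ab by (simp add: sgn_zero_iff)
    show ?thesis
    proof (rule that[of "\<lambda>x. x"])
      fix x :: real assume "x \<in> {0..1}"
      then show "?S x x = ?S 0 0"
        using fim[of x x] True \<open>b = 0\<close> by (intro level) (auto simp: Q_def)
    qed auto
  next
    case False
    \<comment> \<open>The equation of the hyperbola solved for \<open>y\<close>. Because
      \<open>a\<close> and \<open>b\<close> have opposite signs, the two summands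
      \<open>a * x\<close> and \<open>- b * (1 - x)\<close> of the denominator never have opposite
      signs and do not vanish together, so the quotient is a proportion in the unit
      interval.\<close>
    define Y where "Y x = a * x / (a * x - b * (1 - x))" for x
    have den: "(0 < a * x - b * (1 - x) \<and> 0 \<le> a * x \<and> 0 \<le> - (b * (1 - x))) \<or>
        (a * x - b * (1 - x) < 0 \<and> a * x \<le> 0 \<and> - (b * (1 - x)) \<le> 0)" if "x \<in> {0..1}" for x
    proof (cases "a > 0")
      case True
      then have "b < 0" using ab by (simp add: sgn_if split: if_splits)
      then have "0 \<le> a * x" "0 \<le> (- b) * (1 - x)" "0 < a * x \<or> 0 < (- b) * (1 - x)"
        using True that by (cases "x = 0"; auto simp: zero_less_mult_iff mult_nonneg_nonneg mult_nonpos_nonneg)+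
      then show ?thesis by auto
    next
      case nonpos: False
      then have "a < 0" using False by simp
      then have "b > 0" using ab by (simp add: sgn_if split: if_splits)
      then have "a * x \<le> 0" "0 \<le> b * (1 - x)" "a * x < 0 \<or> 0 < b * (1 - x)"
        using \<open>a < 0\<close> that by (cases "x = 0"; auto simp: mult_less_0_iff zero_less_mult_iff mult_nonneg_nonneg mult_nonpos_nonneg)+
      then show ?thesis by auto
    qed
    then have den0: "a * x - b * (1 - x) \<noteq> 0" if "x \<in> {0..1}" for x using that by fastforce
    show ?thesis
    proof (rule that[of Y])
      show "continuous_on {0..1} Y"
        unfolding Y_def using den0 by (intro continuous_intros) auto
      show "Y 0 = 0" "Y 1 = 1" using False by (simp_all add: Y_def)
      fix x :: real assume x: "x \<in> {0..1}"
      show Yx: "Y x \<in> {0..1}"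
        using den[OF x] by (auto simp: Y_def zero_le_divide_iff divide_le_eq_1)
      have "a * x * (1 - Y x) + b * Y x * (1 - x) = 0"
        using den0[OF x] by (simp add: Y_def field_simps)
      then show "?S x (Y x) = ?S 0 0"
        using x Yx fim[of x "Y x"] by (intro level) (auto simp: Q_def)
    qed
  qed
qed

section \<open>Moving frames and the deformation of the two points\<close>

context hermitian
begin

lemma nondegenerate_plane:
  assumes "noneuclidean h (proj_set W)" "vec.subspace W"
  shows "vec.dim W = 2" "x \<in> W \<Longrightarrow> (\<And>y. y \<in> W \<Longrightarrow> h x y = 0) \<Longrightarrow> x = 0"
proof -
  obtain W' where W': "vec.subspace W'" "vec.dim W' = 2" "proj_set W = proj_set W'"
    "\<forall>x\<in>W'. (\<forall>y\<in>W'. h x y = 0) \<longrightarrow> x = 0"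
    using assms(1) unfolding noneuclidean_def by blast
  then have "W = W'" using proj_set_eq_imp_eq assms(2) by blast
  with W' show "vec.dim W = 2" "x \<in> W \<Longrightarrow> (\<And>y. y \<in> W \<Longrightarrow> h x y = 0) \<Longrightarrow> x = 0" by auto
qed

text \<open>If \<open>w\<close> were isotropic, it would be orthogonal to \<open>p\<close> and to
  itself, hence to the whole plane, against nondegeneracy.\<close>

lemma orthogonal_basis:
  assumes W: "noneuclidean h (proj_set W)" "vec.subspace W"
    and pw: "p \<in> W" "w \<in> W" "h w p = 0" "h p p \<noteq> 0" "w \<noteq> 0"
  shows "W = vec.span {p, w}" "h w w \<noteq> 0"
proof -
  have p0: "p \<noteq> 0" using pw(4) zero_left by auto
  have ne: "w \<noteq> p" using pw(3,4) by auto
  have "w \<notin> vec.span {p}"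
  proof
    assume "w \<in> vec.span {p}"
    then obtain c where c: "w = c *s p" by (auto simp: vec.span_singleton)
    then have "c * h p p = 0" using pw(3) scale_left by metis
    then show False using pw(4,5) c by auto
  qed
  then have "vec.independent {w, p}"
    using p0 ne by (simp add: vec.independent_insert)
  then have "vec.dim (vec.span {p, w}) = 2"
    using ne by (metis card_2_iff vec.dim_span_eq_card_independent insert_commute)
  moreover have "vec.span {p, w} \<subseteq> W"
    using pw W(2) by (intro vec.span_minimal) auto
  ultimately show span: "W = vec.span {p, w}"
    using vec.subspace_dim_equal[of "vec.span {p, w}" W] W(2) nondegenerate_plane(1)[OF W] by simp
  show "h w w \<noteq> 0"
  proof
    assume "h w w = 0"
    have "h w y = 0" if "y \<in> W" for y
    proof -
      have "y \<in> vec.span {p, w}" using that span by simp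
      then obtain a where "y - a *s p \<in> vec.span {w}" by (auto simp: vec.span_breakdown_eq)
      then obtain b where "y - a *s p = b *s w" by (auto simp: vec.span_singleton)
      then have "y = b *s w + a *s p" by (metis diff_add_cancel)
      then show ?thesis using \<open>h w w = 0\<close> pw(3) by (simp add: add_right scale_right)
    qed
    then show False using nondegenerate_plane(2)[OF W pw(2)] pw(5) by blast
  qed
qed

text \<open>The norm of \<open>u\<close> is a convex combination, with weight
  \<open>x\<^sup>2\<close>, of the norms at the two ends of the segment. These have the same sign,
  so \<open>u\<close> never becomes isotropic. The companion \<open>u'\<close> is the orthogonal
  vector of \<open>u\<close> in the real plane, scaled so that it is affine in \<open>x\<close>; its
  norm is the product of \<open>h p p\<close>, \<open>h w w\<close> and
  \<open>h u u\<close>.\<close>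

lemma moving_frame:
  fixes p w :: "complex ^ 3" and b x :: real
  defines "u \<equiv> p + (x * b) *\<^sub>R w"
    and "u' \<equiv> (- (Re (h w w) * (x * b))) *\<^sub>R p + Re (h p p) *\<^sub>R w"
  assumes h: "h w p = 0" "h p p \<noteq> 0" "h w w \<noteq> 0"
    and sig: "sgn (Re (h (p + b *\<^sub>R w) (p + b *\<^sub>R w))) = sgn (Re (h p p))" and x: "x \<in> {0..1}"
  shows "u \<in> span {p, w}" "u' \<in> span {p, w}" "h u' u = 0" "h u u \<noteq> 0" "h u' u' \<noteq> 0"
    "sgn (Re (h u u)) = sgn (Re (h p p))"
proof -
  define s t where "s = Re (h p p)" and "t = Re (h w w)"
  have st: "h p p = of_real s" "h w w = of_real t" "h p w = 0"
    unfolding s_def t_def using self_real h(1) eq_0_commute[of p w] by auto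
  have nz: "s \<noteq> 0" "t \<noteq> 0" using h st by auto
  have norm: "h (p + c *\<^sub>R w) (p + c *\<^sub>R w) = of_real (s + c\<^sup>2 * t)" for c
    using h(1) st by (simp add: form_simps power2_eq_square)
  show "u \<in> span {p, w}" "u' \<in> span {p, w}"
    unfolding u_def u'_def using in_span_pair by (metis scaleR_one, blast)
  show perp: "h u' u = 0"
    unfolding u_def u'_def s_def[symmetric] t_def[symmetric] using h(1) st by (simp add: form_simps)
  have "sgn (s + b\<^sup>2 * t) = sgn s" using sig unfolding norm st by simp
  moreover have "0 \<le> x\<^sup>2" "x\<^sup>2 \<le> 1" using x by (auto simp: power_le_one)
  ultimately have sg: "sgn (s + (x * b)\<^sup>2 * t) = sgn s"
  proof -
    assume a: "sgn (s + b\<^sup>2 * t) = sgn s" "0 \<le> x\<^sup>2" "x\<^sup>2 \<le> 1"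
    have "s + (x * b)\<^sup>2 * t = (1 - x\<^sup>2) * s + x\<^sup>2 * (s + b\<^sup>2 * t)"
      by (simp add: algebra_simps power_mult_distrib)
    moreover have "0 < (1 - x\<^sup>2) * s + x\<^sup>2 * (s + b\<^sup>2 * t)" if "s > 0"
    proof (cases "x\<^sup>2 = 1")
      case False
      have "0 \<le> x\<^sup>2 * (s + b\<^sup>2 * t)" "0 < (1 - x\<^sup>2) * s"
        using a that False by (auto simp: sgn_if split: if_splits)
      then show ?thesis by linarith
    qed (use a that in \<open>auto simp: sgn_if split: if_splits\<close>)
    moreover have "(1 - x\<^sup>2) * s + x\<^sup>2 * (s + b\<^sup>2 * t) < 0" if "s < 0"
    proof (cases "x\<^sup>2 = 1")
      case False
      have "x\<^sup>2 * (s + b\<^sup>2 * t) \<le> 0" "(1 - x\<^sup>2) * s < 0"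
        using a that False by (auto simp: sgn_if mult_less_0_iff mult_le_0_iff split: if_splits)
      then show ?thesis by linarith
    qed (use a that in \<open>auto simp: sgn_if split: if_splits\<close>)
    ultimately show ?thesis using nz(1) by (cases "s > 0") (auto simp: sgn_if)
  qed
  have uu: "h u u = of_real (s + (x * b)\<^sup>2 * t)" unfolding u_def by (rule norm)
  show "sgn (Re (h u u)) = sgn (Re (h p p))" unfolding uu st using sg by simp
  have "s + (x * b)\<^sup>2 * t \<noteq> 0" using sg nz(1) by (auto simp: sgn_zero_iff)
  then show "h u u \<noteq> 0" unfolding uu by (metis of_real_eq_0_iff)
  have "h u' u' = of_real (s * t * (s + (x * b)\<^sup>2 * t))"
    unfolding u'_def s_def[symmetric] t_def[symmetric] using h(1) st
    by (simp add: form_simps power2_eq_square algebra_simps)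
  then show "h u' u' \<noteq> 0" using nz \<open>s + (x * b)\<^sup>2 * t \<noteq> 0\<close> by (metis mult_eq_0_iff of_real_eq_0_iff)
qed

text \<open>Up to sign, the first factor is the area form of the plane, normalised by the basis
  \<open>(p1, w1)\<close>, and the second the conjugate of the area form normalised by \<open>(p2, w2)\<close>, both taken at
  the two moving vectors. Two area forms of a plane are proportional, so only the squared modulus of
  the product varies.\<close>

lemma perp_product:
  fixes p1 w1 p2 w2 :: "complex ^ 3" and b1 b2 :: real
  assumes h: "h w1 p1 = 0" "h p1 p1 \<noteq> 0" "h w1 w1 \<noteq> 0" "h w2 p2 = 0" "h p2 p2 \<noteq> 0" "h w2 w2 \<noteq> 0"
    and span: "p1 \<in> vec.span {p2, w2}" "w1 \<in> vec.span {p2, w2}"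
  obtains k where "\<And>c1 c2. \<exists>d. h (p2 + c2 *\<^sub>R w2) ((- (Re (h w1 w1) * c1)) *\<^sub>R p1 + Re (h p1 p1) *\<^sub>R w1) *
      h ((- (Re (h w2 w2) * c2)) *\<^sub>R p2 + Re (h p2 p2) *\<^sub>R w2) (p1 + c1 *\<^sub>R w1) = k * of_real ((cmod d)\<^sup>2)"
proof -
  define s1 t1 s2 t2 where "s1 = Re (h p1 p1)" and "t1 = Re (h w1 w1)"
    and "s2 = Re (h p2 p2)" and "t2 = Re (h w2 w2)"
  have st: "h p1 p1 = of_real s1" "h w1 w1 = of_real t1" "h p2 p2 = of_real s2" "h w2 w2 = of_real t2"
    unfolding s1_def t1_def s2_def t2_def by (rule self_real)+
  have h0: "h p1 w1 = 0" "h p2 w2 = 0" using h eq_0_commute[of p1 w1] eq_0_commute[of p2 w2] by auto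
  \<comment> \<open>Alternating and complex bilinear, thus a multiple of the determinant on the
    plane: in the basis \<open>p2\<close>, \<open>w2\<close> the vectors \<open>u2\<close>,
    \<open>u1\<close> have determinant \<open>Y - c2 * X\<close>.\<close>
  define D where "D x y = h x p1 * h y w1 - h x w1 * h y p1" for x y
  show thesis
  proof (rule that[of "- of_real (s2 * t2) * D p2 w2"])
    fix c1 c2 :: real
    define u1 where "u1 = p1 + c1 *\<^sub>R w1"
    have "u1 \<in> vec.span {p2, w2}"
      unfolding u1_def scaleR_eq_scale using span by (intro vec.span_add vec.span_scale)
    then obtain X Y where u1: "u1 = X *s p2 + Y *s w2"
      using orthogonal_expansion h by blast
    define u2 where "u2 = p2 + c2 *\<^sub>R w2"
    have "h u1 p1 = of_real s1" "h u1 w1 = of_real (c1 * t1)"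
      unfolding u1_def using h h0 st by (simp_all add: form_simps)
    then have "h u2 ((- (t1 * c1)) *\<^sub>R p1 + s1 *\<^sub>R w1) = - D u2 u1"
      by (simp add: D_def form_simps)
    also have "D u2 u1 = (Y - of_real c2 * X) * D p2 w2"
      unfolding D_def u1 u2_def by (simp add: form_simps) algebra
    finally have 1: "h u2 ((- (t1 * c1)) *\<^sub>R p1 + s1 *\<^sub>R w1) = - ((Y - of_real c2 * X) * D p2 w2)" .
    \<comment> \<open>The same determinant returns conjugated, because \<open>u1\<close> now stands
      in the second, conjugate-linear argument.\<close>
    have 2: "h ((- (t2 * c2)) *\<^sub>R p2 + s2 *\<^sub>R w2) u1 = of_real (s2 * t2) * cnj (Y - of_real c2 * X)"
      unfolding u1 using h h0 st by (simp add: form_simps algebra_simps)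
    have "h u2 ((- (t1 * c1)) *\<^sub>R p1 + s1 *\<^sub>R w1) * h ((- (t2 * c2)) *\<^sub>R p2 + s2 *\<^sub>R w2) u1 =
        - of_real (s2 * t2) * D p2 w2 * of_real ((cmod (Y - of_real c2 * X))\<^sup>2)"
      unfolding 1 2 complex_norm_square by (simp add: mult_ac)
    then show "\<exists>d. h (p2 + c2 *\<^sub>R w2) ((- (Re (h w1 w1) * c1)) *\<^sub>R p1 + Re (h p1 p1) *\<^sub>R w1) *
      h ((- (Re (h w2 w2) * c2)) *\<^sub>R p2 + Re (h p2 p2) *\<^sub>R w2) (p1 + c1 *\<^sub>R w1) =
      - of_real (s2 * t2) * D p2 w2 * of_real ((cmod d)\<^sup>2)"
      unfolding u1_def u2_def s1_def[symmetric] t1_def[symmetric] s2_def[symmetric] t2_def[symmetric]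
      by blast
  qed
qed

text \<open>Both points run over affine segments in the real planes of their geodesics, the first at
  unit speed in the parameter and the second along the reparametrisation \<open>Y\<close> found by
  \<open>angle_sum_level_curve\<close>.\<close>

lemma constant_angle_sum_path:
  assumes L: "noneuclidean h L" "L = cline p1 p2" "geodesic h L G1" "geodesic h L G2"
    and p: "p1 \<in> G1" "p2 \<in> G2" "nonisotropic h p1" "nonisotropic h p2"
    and q: "q1 \<in> G1" "q2 \<in> G2" "sig h p1 = sig h q1" "sig h p2 = sig h q2"
    and pq: "\<not> orthog h p1 q1" "\<not> orthog h p2 q2"
    and arcs: "geodesic_arc h p1 q1 \<inter> (G1 \<inter> G2) = {}" "geodesic_arc h p2 q2 \<inter> (G1 \<inter> G2) = {}"
    and sum: "angle h p1 G1 (geodesic_through h p1 p2) + angle h p2 (geodesic_through h p1 p2) G2 =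
      angle h q1 G1 (geodesic_through h q1 q2) + angle h q2 (geodesic_through h q1 q2) G2"
  obtains \<gamma>1 \<gamma>2 where "continuous_on {0..1::real} \<gamma>1" "continuous_on {0..1} \<gamma>2"
    "\<gamma>1 0 = p1" "\<gamma>2 0 = p2" "\<gamma>1 1 = q1" "\<gamma>2 1 = q2"
    "\<And>t. t \<in> {0..1} \<Longrightarrow> \<gamma>1 t \<in> G1 \<and> \<gamma>2 t \<in> G2 \<and> sig h (\<gamma>1 t) = sig h p1 \<and> sig h (\<gamma>2 t) = sig h p2 \<and>
      \<gamma>1 t \<noteq> \<gamma>2 t \<and> \<not> orthog h (\<gamma>1 t) (\<gamma>2 t)"
    "\<And>t. t \<in> {0..1} \<Longrightarrow>
      angle h (\<gamma>1 t) G1 (geodesic_through h (\<gamma>1 t) (\<gamma>2 t)) \<in> {0<..<pi} \<and>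
      angle h (\<gamma>2 t) (geodesic_through h (\<gamma>1 t) (\<gamma>2 t)) G2 \<in> {0<..<pi} \<and>
      angle h (\<gamma>1 t) G1 (geodesic_through h (\<gamma>1 t) (\<gamma>2 t)) + angle h (\<gamma>2 t) (geodesic_through h (\<gamma>1 t) (\<gamma>2 t)) G2 =
      angle h p1 G1 (geodesic_through h p1 p2) + angle h p2 (geodesic_through h p1 p2) G2"
proof -
  obtain P1 where P1: "P1 \<noteq> 0" "p1 = proj P1" by (rule proj_cases)
  obtain P2 where P2: "P2 \<noteq> 0" "p2 = proj P2" by (rule proj_cases)
  define W where "W = vec.span {P1, P2}"
  have LW: "L = proj_set W" unfolding L(2) P1(2) P2(2) W_def using cline_proj P1(1) P2(1) by blast
  have W: "noneuclidean h (proj_set W)" "vec.subspace W" using L(1) LW by (simp_all add: W_def)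
  \<comment> \<open>Stated once for both geodesics: an orthogonal basis beginning with the given
    representative, in which the endpoint has affine coordinate \<open>b\<close>.\<close>
  have frame: "\<exists>w b. geodesic_space h (span {P, w}) \<and> G = proj_set (span {P, w}) \<and>
      h w P = 0 \<and> h P P \<noteq> 0 \<and> h w w \<noteq> 0 \<and> span {P, w} \<subseteq> W \<and>
      x = proj (P + b *\<^sub>R w) \<and> sgn (Re (h (P + b *\<^sub>R w) (P + b *\<^sub>R w))) = sgn (Re (h P P))"
    if G: "geodesic h L G" "proj P \<in> G" "x \<in> G" and P: "P \<noteq> 0" "nonisotropic h (proj P)"
      and x: "sig h (proj P) = sig h x" "\<not> orthog h (proj P) x" for G x P
  proof -
    have PP: "h P P \<noteq> 0" using P nonisotropic_proj by blast
    obtain U where U: "geodesic_space h U" "G = proj_set U" "P \<in> U" "proj_set U \<subseteq> L"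
      using geodesic_obtain_space[OF G(1) P(1) G(2)] by blast
    obtain w where w: "w \<in> U" "w \<noteq> 0" "h w P = 0" "U = span {P, w}"
      using geodesic_space_basis[OF U(1,3) PP] by blast
    have UW: "v \<in> W" if "v \<in> U" for v
    proof (cases "v = 0")
      case False
      then have "proj v \<in> proj_set W" using that U(4) LW by (auto simp: proj_set_def)
      then show ?thesis using proj_in_proj_set[OF W(2) False] by blast
    qed (simp add: W_def vec.span_zero)
    have "h w w \<noteq> 0"
      using orthogonal_basis[OF W UW[OF U(3)] UW[OF w(1)] w(3) PP w(2)] by blast
    obtain v where v: "v \<noteq> 0" "x = proj v" by (rule proj_cases)
    have "\<not> orthog h x (proj P)"
      using x(2) v P(1) eq_0_commute[of P v] by (simp add: orthog_proj)
    then obtain b where b: "x = proj (P + b *\<^sub>R w)" "P + b *\<^sub>R w \<noteq> 0"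
      using geodesic_point[of x P w] G(3) U(2) w(3,4) P(1) by blast
    then have "sgn (Re (h (P + b *\<^sub>R w) (P + b *\<^sub>R w))) = sgn (Re (h P P))"
      using x(1) sig_proj P(1) by metis
    then show ?thesis using U w PP UW b(1) \<open>h w w \<noteq> 0\<close> by blast
  qed
  obtain w1 b1 where f1: "geodesic_space h (span {P1, w1})" "G1 = proj_set (span {P1, w1})"
      "h w1 P1 = 0" "h P1 P1 \<noteq> 0" "h w1 w1 \<noteq> 0" "span {P1, w1} \<subseteq> W"
      "q1 = proj (P1 + b1 *\<^sub>R w1)" "sgn (Re (h (P1 + b1 *\<^sub>R w1) (P1 + b1 *\<^sub>R w1))) = sgn (Re (h P1 P1))"
    using frame[of G1 P1 q1] L p q pq P1 by blast
  obtain w2 b2 where f2: "geodesic_space h (span {P2, w2})" "G2 = proj_set (span {P2, w2})"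
      "h w2 P2 = 0" "h P2 P2 \<noteq> 0" "h w2 w2 \<noteq> 0" "span {P2, w2} \<subseteq> W"
      "q2 = proj (P2 + b2 *\<^sub>R w2)" "sgn (Re (h (P2 + b2 *\<^sub>R w2) (P2 + b2 *\<^sub>R w2))) = sgn (Re (h P2 P2))"
    using frame[of G2 P2 q2] L p q pq P2 by blast
  define u1 where "u1 x = P1 + (x * b1) *\<^sub>R w1" for x
  define u1' where "u1' x = (- (Re (h w1 w1) * (x * b1))) *\<^sub>R P1 + Re (h P1 P1) *\<^sub>R w1" for x
  define u2 where "u2 y = P2 + (y * b2) *\<^sub>R w2" for y
  define u2' where "u2' y = (- (Re (h w2 w2) * (y * b2))) *\<^sub>R P2 + Re (h P2 P2) *\<^sub>R w2" for y
  note F1 = moving_frame[OF f1(3,4,5,8), folded u1_def u1'_def]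
  note F2 = moving_frame[OF f2(3,4,5,8), folded u2_def u2'_def]
  have nz: "v \<noteq> 0" if "h v v \<noteq> 0" for v using that zero_left by auto
  have span1: "W = vec.span {u1 x, u1' x}" if "x \<in> {0..1}" for x
    using orthogonal_basis(1)[OF W, of "u1 x" "u1' x"] F1[OF that] f1(6) nz by blast
  have span2: "W = vec.span {u2 y, u2' y}" if "y \<in> {0..1}" for y
    using orthogonal_basis(1)[OF W, of "u2 y" "u2' y"] F2[OF that] f2(6) nz by blast
  have inW: "u1 x \<in> W" "u2 x \<in> W" if "x \<in> {0..1}" for x
    using F1(1)[OF that] F2(1)[OF that] f1(6) f2(6) by blast+
  have inG: "proj (u1 x) \<in> G1" "proj (u2 x) \<in> G2" if "x \<in> {0..1}" for x
    unfolding f1(2) f2(2) proj_set_def using F1(1,4)[OF that] F2(1,4)[OF that] nz by blast+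
  \<comment> \<open>Here the hypothesis on the arcs enters: the moving points trace exactly these
    arcs, so each of them stays off the other geodesic.\<close>
  have notG: "proj (u1 x) \<notin> G2" "proj (u2 x) \<notin> G1" if "x \<in> {0..1}" for x
  proof -
    have "proj (u1 x) \<in> geodesic_arc h p1 q1"
      unfolding P1(2) f1(7) geodesic_arc_segment[OF f1(1,3,4,5)] u1_def using that by blast
    then show "proj (u1 x) \<notin> G2" using arcs(1) inG[OF that] by blast
    have "proj (u2 x) \<in> geodesic_arc h p2 q2"
      unfolding P2(2) f2(7) geodesic_arc_segment[OF f2(1,3,4,5)] u2_def using that by blast
    then show "proj (u2 x) \<notin> G1" using arcs(2) inG[OF that] by blast
  qed
  define f where "f x y = h (u1 x) (u2 y)" for x y
  \<comment> \<open>The numbers whose \<open>ang\<close> are the two angles, as in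
    \<open>angle_geodesic_through\<close>. For \<open>B\<close> the conjugate is taken, because at
    the second point the angle runs from the connecting geodesic to \<open>G2\<close>.\<close>
  define A where "A x y = f x y * h (u2 y) (u1' x)" for x y
  define B where "B x y = f x y * h (u2' y) (u1 x)" for x y
  have B: "B x y = cnj (h (u2 y) (u1 x) * h (u1 x) (u2' y))" for x y
    unfolding B_def f_def using commute[of "u2 y" "u1 x"] commute[of "u1 x" "u2' y"] by simp
  have ImA: "Im (A x y) \<noteq> 0" and ImB: "Im (B x y) \<noteq> 0" if "x \<in> {0..1}" "y \<in> {0..1}" for x y
  proof -
    have "u2 y \<in> vec.span {u1 x, u1' x}" "u2 y \<noteq> 0"
      using inW(2) span1 F2(4) nz that by metis+
    then show "Im (A x y) \<noteq> 0"
      using real_imp_in_geodesic[OF f1(1) F1(1-5)] that notG(2) unfolding A_def f_def f1(2) by blast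
    have "u1 x \<in> vec.span {u2 y, u2' y}" "u1 x \<noteq> 0"
      using inW(1) span2 F1(4) nz that by metis+
    then have "Im (h (u2 y) (u1 x) * h (u1 x) (u2' y)) \<noteq> 0"
      using real_imp_in_geodesic[OF f2(1) F2(1-5)] that notG(1) unfolding f2(2) by blast
    then show "Im (B x y) \<noteq> 0" unfolding B by (simp only: cnj.simps(2) neg_equal_0_iff_equal not_False_eq_True)
  qed
  have angA: "angle h (proj (u1 x)) G1 (geodesic_through h (proj (u1 x)) (proj (u2 y))) = ang (A x y)"
    and angB: "angle h (proj (u2 y)) (geodesic_through h (proj (u1 x)) (proj (u2 y))) G2 = ang (B x y)"
    if xy: "x \<in> {0..1}" "y \<in> {0..1}" for x y
  proof -
    have "u2 y \<in> vec.span {u1 x, u1' x}" using inW(2) span1 xy by metis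
    then show "angle h (proj (u1 x)) G1 (geodesic_through h (proj (u1 x)) (proj (u2 y))) = ang (A x y)"
      using angle_geodesic_through(1)[OF f1(1) F1(1-5)[OF xy(1)]] ImA[OF xy] unfolding A_def f_def f1(2) by blast
    have "u1 x \<in> vec.span {u2 y, u2' y}" using inW(1) span2 xy by metis
    moreover have "Im (h (u2 y) (u1 x) * h (u1 x) (u2' y)) \<noteq> 0"
      using ImB[OF xy] unfolding B by (simp only: cnj.simps(2) neg_equal_0_iff_equal not_False_eq_True)
    ultimately show "angle h (proj (u2 y)) (geodesic_through h (proj (u1 x)) (proj (u2 y))) G2 = ang (B x y)"
      using angle_geodesic_through(2)[OF f2(1) F2(1-5)[OF xy(2)]]
      unfolding B f2(2) geodesic_through_commute[of "proj (u1 x)"] by blast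
  qed
  have ends: "proj (u1 0) = p1" "proj (u2 0) = p2" "proj (u1 1) = q1" "proj (u2 1) = q2"
    by (simp_all add: u1_def u2_def P1(2) P2(2) f1(7) f2(7))
  have "P1 \<in> vec.span {P2, w2}" "w1 \<in> vec.span {P2, w2}"
  proof -
    have "P2 \<in> W" "w2 \<in> W" "w2 \<noteq> 0" using f2(5,6) nz by (auto intro: span_base)
    then have "W = vec.span {P2, w2}" using orthogonal_basis(1)[OF W] f2(3,4) by blast
    then show "P1 \<in> vec.span {P2, w2}" "w1 \<in> vec.span {P2, w2}" using f1(6) by (auto intro: span_base)
  qed
  then obtain k where k: "\<And>c1 c2. \<exists>d. h (P2 + c2 *\<^sub>R w2) ((- (Re (h w1 w1) * c1)) *\<^sub>R P1 + Re (h P1 P1) *\<^sub>R w1) *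
      h ((- (Re (h w2 w2) * c2)) *\<^sub>R P2 + Re (h P2 P2) *\<^sub>R w2) (P1 + c1 *\<^sub>R w1) = k * of_real ((cmod d)\<^sup>2)"
    using perp_product[OF f1(3-5) f2(3-5)] by blast
  \<comment> \<open>\<open>perp_product\<close> yields a number separately for each pair of points;
    only its squared modulus enters, as the positive factor in \<open>prod\<close>.\<close>
  define d where "d x y = (SOME d. h (u2 y) (u1' x) * h (u2' y) (u1 x) = k * of_real ((cmod d)\<^sup>2))" for x y
  have "\<exists>d. h (u2 y) (u1' x) * h (u2' y) (u1 x) = k * of_real ((cmod d)\<^sup>2)" for x y
    unfolding u1_def u1'_def u2_def u2'_def by (rule k)
  then have d: "h (u2 y) (u1' x) * h (u2' y) (u1 x) = k * of_real ((cmod (d x y))\<^sup>2)" for x y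
    unfolding d_def by (rule someI_ex)
  have prod: "A x y * B x y = k * of_real ((cmod (d x y))\<^sup>2) * (f x y)\<^sup>2" for x y
    unfolding d[symmetric] A_def B_def by (simp add: power2_eq_square)
  obtain Y where Y: "continuous_on {0..1} Y" "Y 0 = 0" "Y 1 = 1" "\<And>x. x \<in> {0..1} \<Longrightarrow> Y x \<in> {0..1}"
    "\<And>x. x \<in> {0..1} \<Longrightarrow> ang (A x (Y x)) + ang (B x (Y x)) = ang (A 0 0) + ang (B 0 0)"
  proof (rule angle_sum_level_curve[of f A B k "\<lambda>x y. (cmod (d x y))\<^sup>2" "- b2 / Re (h P2 P2)"])
    show "f x y = f 0 0 + of_real x * (f 1 0 - f 0 0) + of_real y * (f 0 1 - f 0 0)
      + of_real (x * y) * (f 1 1 - f 1 0 - f 0 1 + f 0 0)" for x y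
      unfolding f_def u1_def u2_def by (simp add: form_simps algebra_simps)
    have cf: "continuous_on ({0..1} \<times> {0..1}) (\<lambda>z. f (fst z) (snd z))"
      unfolding f_def u1_def u2_def form_simps by (intro continuous_intros)
    show "continuous_on ({0..1} \<times> {0..1}) (\<lambda>(x, y). A x y)"
      unfolding case_prod_unfold A_def u1'_def u2_def form_simps by (intro continuous_intros cf)
    show "continuous_on ({0..1} \<times> {0..1}) (\<lambda>(x, y). B x y)"
      unfolding case_prod_unfold B_def u2'_def u1_def form_simps by (intro continuous_intros cf)
    show "Im (A x y) \<noteq> 0" "Im (B x y) \<noteq> 0" if "(x, y) \<in> {0..1} \<times> {0..1}" for x y
      using ImA ImB that by auto
    show "A x y * B x y = k * of_real ((cmod (d x y))\<^sup>2) * (f x y)\<^sup>2" for x y by (rule prod)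
    show "(cmod (d x y))\<^sup>2 > 0" if "(x, y) \<in> {0..1} \<times> {0..1}" for x y
    proof -
      have "A x y * B x y \<noteq> 0" using ImA[of x y] ImB[of x y] that by auto
      then have "d x y \<noteq> 0" unfolding prod by auto
      then show ?thesis by simp
    qed
    \<comment> \<open>Origin of the constant \<open>- b2 / Re (h P2 P2)\<close>: along a vertical
      edge \<open>f\<close> changes by \<open>b2\<close> times \<open>h (u1 x) w2\<close>, while
      \<open>u2' 0\<close> is \<open>Re (h P2 P2)\<close> times \<open>w2\<close>, so
      \<open>B x 0\<close> contains the conjugate of the same value. The conjugation produces the
      minus sign.\<close>
    show "Im (f x 1 * cnj (f x 0)) = - b2 / Re (h P2 P2) * Im (B x 0)" for x
    proof -
      define s2 where "s2 = Re (h P2 P2)"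
      have "h P2 P2 = of_real s2" unfolding s2_def by (rule self_real)
      then have "s2 \<noteq> 0" using f2(4) by auto
      have "f x 1 = f x 0 + of_real b2 * h (u1 x) w2" by (simp add: f_def u2_def form_simps)
      moreover have "B x 0 = f x 0 * (of_real s2 * cnj (h (u1 x) w2))"
        unfolding B_def u2'_def s2_def using commute[of "u1 x" w2] by (simp add: scaleR_left)
      ultimately show ?thesis
        unfolding s2_def[symmetric] using \<open>s2 \<noteq> 0\<close> by (simp add: field_simps)
    qed
    show "ang (A 0 0) + ang (B 0 0) = ang (A 1 1) + ang (B 1 1)"
      using sum angA[of 0 0] angB[of 0 0] angA[of 1 1] angB[of 1 1] unfolding ends by simp
  qed blast
  show thesis
  proof (rule that[of "\<lambda>t. proj (u1 t)" "\<lambda>t. proj (u2 (Y t))"])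
    show "continuous_on {0..1} (\<lambda>t. proj (u1 t))"
      using F1(4) nz by (intro continuous_on_proj) (auto simp: u1_def intro!: continuous_intros)
    show "continuous_on {0..1} (\<lambda>t. proj (u2 (Y t)))"
    proof (rule continuous_on_proj)
      show "continuous_on {0..1} (\<lambda>t. u2 (Y t))"
        unfolding u2_def using Y(1) by (intro continuous_intros)
      show "u2 (Y t) \<noteq> 0" if "t \<in> {0..1}" for t using F2(4) nz Y(4) that by blast
    qed
    show "proj (u1 0) = p1" "proj (u2 (Y 0)) = p2" "proj (u1 1) = q1" "proj (u2 (Y 1)) = q2"
      by (simp_all only: ends Y(2,3))
    fix t :: real assume t: "t \<in> {0..1}"
    note Yt = Y(4)[OF t]
    have u0: "u1 t \<noteq> 0" "u2 (Y t) \<noteq> 0" using F1(4)[OF t] F2(4)[OF Yt] nz by auto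
    have "h (u1 t) (u2 (Y t)) \<noteq> 0" using ImA[OF t Yt] by (auto simp: A_def f_def)
    then have "\<not> orthog h (proj (u1 t)) (proj (u2 (Y t)))" using u0 by (simp add: orthog_proj)
    moreover have "sig h (proj (u1 t)) = sig h p1" "sig h (proj (u2 (Y t))) = sig h p2"
      unfolding P1(2) P2(2) using sig_proj u0 P1(1) P2(1) F1(6)[OF t] F2(6)[OF Yt] by simp_all
    ultimately show "proj (u1 t) \<in> G1 \<and> proj (u2 (Y t)) \<in> G2 \<and> sig h (proj (u1 t)) = sig h p1 \<and>
      sig h (proj (u2 (Y t))) = sig h p2 \<and> proj (u1 t) \<noteq> proj (u2 (Y t)) \<and>
      \<not> orthog h (proj (u1 t)) (proj (u2 (Y t)))"
      using inG(1)[OF t] inG(2)[OF Yt] notG(2)[OF Yt] by metis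
    have "ang (A t (Y t)) + ang (B t (Y t)) =
        angle h p1 G1 (geodesic_through h p1 p2) + angle h p2 (geodesic_through h p1 p2) G2"
      using Y(5)[OF t] angA[of 0 0] angB[of 0 0] unfolding ends by simp
    then show "angle h (proj (u1 t)) G1 (geodesic_through h (proj (u1 t)) (proj (u2 (Y t)))) \<in> {0<..<pi} \<and>
      angle h (proj (u2 (Y t))) (geodesic_through h (proj (u1 t)) (proj (u2 (Y t)))) G2 \<in> {0<..<pi} \<and>
      angle h (proj (u1 t)) G1 (geodesic_through h (proj (u1 t)) (proj (u2 (Y t)))) +
        angle h (proj (u2 (Y t))) (geodesic_through h (proj (u1 t)) (proj (u2 (Y t)))) G2 =
      angle h p1 G1 (geodesic_through h p1 p2) + angle h p2 (geodesic_through h p1 p2) G2"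
      unfolding angA[OF t Yt] angB[OF t Yt]
      using ang_polar(1,2)[OF ImA[OF t Yt]] ang_polar(1,2)[OF ImB[OF t Yt]] by simp
  qed
qed

end

section \<open>Translation between angle sums and products of parameters\<close>

theorem theorem6p5:
  fixes h :: "complex ^ 3 \<Rightarrow> complex ^ 3 \<Rightarrow> complex"
    and p1 p2 q1 q2 :: cp2 and \<alpha>1 \<alpha>2 \<beta>1 \<beta>2 :: complex
  assumes "hermitian_form h" and "signature_ppm h"
    and "f_configuration h (p1, p2, \<alpha>1, \<alpha>2) (q1, q2, \<beta>1, \<beta>2)"
  shows "f_connected h (p1, p2, \<alpha>1, \<alpha>2) (q1, q2, \<beta>1, \<beta>2) \<longleftrightarrow>
    \<alpha>1 * \<alpha>2 = \<beta>1 * \<beta>2 \<and> same_component \<alpha>1 \<beta>1 \<and> same_component \<alpha>2 \<beta>2"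
proof
  assume "f_connected h (p1, p2, \<alpha>1, \<alpha>2) (q1, q2, \<beta>1, \<beta>2)"
  then obtain a b :: real and \<eta>1 \<eta>2 where ab: "a < b" "\<eta>1 b = \<beta>1" "\<eta>2 b = \<beta>2"
    and \<eta>: "\<forall>t\<in>{a..b}. same_component (\<eta>1 t) \<alpha>1 \<and> same_component (\<eta>2 t) \<alpha>2 \<and> \<eta>1 t * \<eta>2 t = \<alpha>1 * \<alpha>2"
    unfolding f_connected.simps by blast
  \<comment> \<open>The conditions on the deformation are evaluated at its right end, where it
    reaches the second tuple.\<close>
  then have "same_component \<beta>1 \<alpha>1 \<and> same_component \<beta>2 \<alpha>2 \<and> \<beta>1 * \<beta>2 = \<alpha>1 * \<alpha>2"
    using bspec[OF \<eta>, of b] by simp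
  then show "\<alpha>1 * \<alpha>2 = \<beta>1 * \<beta>2 \<and> same_component \<alpha>1 \<beta>1 \<and> same_component \<alpha>2 \<beta>2"
    unfolding same_component_def by auto
next
  interpret hermitian h using assms(1) by unfold_locales
  assume *: "\<alpha>1 * \<alpha>2 = \<beta>1 * \<beta>2 \<and> same_component \<alpha>1 \<beta>1 \<and> same_component \<alpha>2 \<beta>2"
  obtain j1 \<theta>1 \<phi>1 where j1: "j1 \<in> {0, 1, 2}" "\<alpha>1 = omega ^ j1 * cis \<theta>1" "0 < \<theta>1" "\<theta>1 < 2 * pi / 3"
    "\<beta>1 = omega ^ j1 * cis \<phi>1" "0 < \<phi>1" "\<phi>1 < 2 * pi / 3" using * same_componentE by blast
  obtain j2 \<theta>2 \<phi>2 where j2: "j2 \<in> {0, 1, 2}" "\<alpha>2 = omega ^ j2 * cis \<theta>2" "0 < \<theta>2" "\<theta>2 < 2 * pi / 3"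
    "\<beta>2 = omega ^ j2 * cis \<phi>2" "0 < \<phi>2" "\<phi>2 < 2 * pi / 3" using * same_componentE by blast
  have prod: "(omega ^ j1 * cis x) * (omega ^ j2 * cis y) = omega ^ (j1 + j2) * cis (x + y)" for x y
    by (simp add: power_add cis_mult[symmetric])
  have "omega ^ (j1 + j2) * cis (\<theta>1 + \<theta>2) = omega ^ (j1 + j2) * cis (\<phi>1 + \<phi>2)"
    using * j1(2,5) j2(2,5) prod by metis
  then have "cis (\<theta>1 + \<theta>2) = cis (\<phi>1 + \<phi>2)"
    by (simp add: omega_def)
  \<comment> \<open>Each sum lies strictly between 0 and \<open>4 * pi / 3\<close>, so equal values
    of \<open>cis\<close> cannot hide a full turn.\<close>
  moreover have "\<bar>\<theta>1 + \<theta>2 - (\<phi>1 + \<phi>2)\<bar> < 2 * pi"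
    using j1(3,4,6,7) j2(3,4,6,7) pi_gt_zero by (simp add: abs_less_iff)
  ultimately have sum: "\<theta>1 + \<theta>2 = \<phi>1 + \<phi>2" by (rule cis_eq_imp_eq)
  from assms(3) obtain G H G1 G2 where
    G: "associated_geodesics h (p1, p2, \<alpha>1, \<alpha>2) G G1 G2" and
    H: "associated_geodesics h (q1, q2, \<beta>1, \<beta>2) H G1 G2" and
    arcs: "geodesic_arc h p1 q1 \<inter> (G1 \<inter> G2) = {}" "geodesic_arc h p2 q2 \<inter> (G1 \<inter> G2) = {}"
    unfolding f_configuration.simps by blast
  have conf: "p1 \<noteq> p2" "\<not> orthog h p1 p2" "q1 \<noteq> q2" "\<not> orthog h q1 q2" "nonisotropic h p1" "nonisotropic h p2"
    "cline p1 p2 = cline q1 q2" "noneuclidean h (cline p1 p2)" "sig h p1 = sig h q1" "sig h p2 = sig h q2"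
    "\<not> orthog h p1 q1" "\<not> orthog h p2 q2"
    using assms(3) unfolding f_configuration.simps by blast+
  have through: "geodesic_through h p1 p2 = G" "geodesic_through h q1 q2 = H"
    using conf G H by (simp_all add: geodesic_through_eqI)
  have arg: "Arg2pi (primitive (omega ^ j * cis x) ^ 3) = 3 * x / 2" if "0 < x" "x < 2 * pi / 3" for j x
    unfolding primitive_arc[OF that] by (rule Arg2pi_cis_cube[OF that])
  have ang_p: "angle h p1 G1 G = 3 * \<theta>1 / 2" "angle h p2 G G2 = 3 * \<theta>2 / 2"
    using G arg[OF j1(3,4), of j1] arg[OF j2(3,4), of j2] j1(2) j2(2) by simp_all
  have ang_q: "angle h q1 G1 H = 3 * \<phi>1 / 2" "angle h q2 H G2 = 3 * \<phi>2 / 2"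
    using H arg[OF j1(6,7), of j1] arg[OF j2(6,7), of j2] j1(5) j2(5) by simp_all
  define \<Theta>1 where "\<Theta>1 \<gamma>1 \<gamma>2 = angle h \<gamma>1 G1 (geodesic_through h \<gamma>1 \<gamma>2)" for \<gamma>1 \<gamma>2
  define \<Theta>2 where "\<Theta>2 \<gamma>1 \<gamma>2 = angle h \<gamma>2 (geodesic_through h \<gamma>1 \<gamma>2) G2" for \<gamma>1 \<gamma>2
  obtain \<gamma>1 \<gamma>2 where \<gamma>: "continuous_on {0..1::real} \<gamma>1" "continuous_on {0..1} \<gamma>2"
    "\<gamma>1 0 = p1" "\<gamma>2 0 = p2" "\<gamma>1 1 = q1" "\<gamma>2 1 = q2"
    and \<gamma>_in: "\<And>t. t \<in> {0..1} \<Longrightarrow> \<gamma>1 t \<in> G1 \<and> \<gamma>2 t \<in> G2 \<and> sig h (\<gamma>1 t) = sig h p1 \<and>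
      sig h (\<gamma>2 t) = sig h p2 \<and> \<gamma>1 t \<noteq> \<gamma>2 t \<and> \<not> orthog h (\<gamma>1 t) (\<gamma>2 t)"
    and \<gamma>_ang: "\<And>t. t \<in> {0..1} \<Longrightarrow> \<Theta>1 (\<gamma>1 t) (\<gamma>2 t) \<in> {0<..<pi} \<and> \<Theta>2 (\<gamma>1 t) (\<gamma>2 t) \<in> {0<..<pi} \<and>
      \<Theta>1 (\<gamma>1 t) (\<gamma>2 t) + \<Theta>2 (\<gamma>1 t) (\<gamma>2 t) = \<Theta>1 p1 p2 + \<Theta>2 p1 p2"
    unfolding \<Theta>1_def \<Theta>2_def
  proof (rule constant_angle_sum_path[where L = "cline p1 p2"])
    show "angle h p1 G1 (geodesic_through h p1 p2) + angle h p2 (geodesic_through h p1 p2) G2 =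
      angle h q1 G1 (geodesic_through h q1 q2) + angle h q2 (geodesic_through h q1 q2) G2"
      unfolding through ang_p ang_q using sum by (simp add: field_simps)
  qed (use conf G H arcs in simp_all)
  \<comment> \<open>The inverse of the passage from parameter to angle: an angle between 0 and pi
    gives an argument between 0 and \<open>2 * pi / 3\<close> inside the component with index
    \<open>j1\<close>.\<close>
  define \<eta>1 where "\<eta>1 t = omega ^ j1 * cis (2 * \<Theta>1 (\<gamma>1 t) (\<gamma>2 t) / 3)" for t
  define \<eta>2 where "\<eta>2 t = omega ^ j2 * cis (2 * \<Theta>2 (\<gamma>1 t) (\<gamma>2 t) / 3)" for t
  \<comment> \<open>The functions \<open>h1\<close> and \<open>h2\<close> of
    \<open>f_connected\<close> are instantiated by the primitives of \<open>\<eta>1\<close> and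
    \<open>\<eta>2\<close>. The two reflexive equations are kept so that the statement matches the
    unfolded definition.\<close>
  have deformation: "\<gamma>1 t \<in> G1 \<and> \<gamma>2 t \<in> G2 \<and>
      sig h (\<gamma>1 t) = sig h p1 \<and> sig h (\<gamma>2 t) = sig h p2 \<and>
      \<gamma>1 t \<noteq> \<gamma>2 t \<and> \<not> orthog h (\<gamma>1 t) (\<gamma>2 t) \<and>
      primitive (\<eta>1 t) \<in> J_arc \<and> primitive (\<eta>2 t) \<in> J_arc \<and>
      angle h (\<gamma>1 t) G1 (geodesic_through h (\<gamma>1 t) (\<gamma>2 t)) = Arg2pi (primitive (\<eta>1 t) ^ 3) \<and>
      angle h (\<gamma>2 t) (geodesic_through h (\<gamma>1 t) (\<gamma>2 t)) G2 = Arg2pi (primitive (\<eta>2 t) ^ 3) \<and>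
      is_parameter (\<eta>1 t) \<and> same_component (\<eta>1 t) \<alpha>1 \<and> primitive (\<eta>1 t) = primitive (\<eta>1 t) \<and>
      is_parameter (\<eta>2 t) \<and> same_component (\<eta>2 t) \<alpha>2 \<and> primitive (\<eta>2 t) = primitive (\<eta>2 t) \<and>
      \<eta>1 t * \<eta>2 t = \<alpha>1 * \<alpha>2" if t: "t \<in> {0..1}" for t
  proof -
    define x where "x = 2 * \<Theta>1 (\<gamma>1 t) (\<gamma>2 t) / 3"
    define y where "y = 2 * \<Theta>2 (\<gamma>1 t) (\<gamma>2 t) / 3"
    have x: "0 < x" "x < 2 * pi / 3" and y: "0 < y" "y < 2 * pi / 3"
      using \<gamma>_ang[OF t] by (simp_all add: x_def y_def)
    have "x + y = \<theta>1 + \<theta>2"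
      using \<gamma>_ang[OF t] ang_p through unfolding \<Theta>1_def \<Theta>2_def x_def y_def by simp
    then have "\<eta>1 t * \<eta>2 t = \<alpha>1 * \<alpha>2"
      unfolding \<eta>1_def \<eta>2_def x_def[symmetric] y_def[symmetric] j1(2) j2(2) prod by simp
    moreover have "\<Theta>1 (\<gamma>1 t) (\<gamma>2 t) = Arg2pi (primitive (\<eta>1 t) ^ 3)"
      "\<Theta>2 (\<gamma>1 t) (\<gamma>2 t) = Arg2pi (primitive (\<eta>2 t) ^ 3)"
      unfolding \<eta>1_def \<eta>2_def x_def[symmetric] y_def[symmetric] arg[OF x] arg[OF y]
      by (simp_all add: x_def y_def)
    moreover have "cis (x / 2) \<in> J_arc" "cis (y / 2) \<in> J_arc"
      using x y unfolding J_arc_def by auto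
    then have "primitive (\<eta>1 t) \<in> J_arc" "primitive (\<eta>2 t) \<in> J_arc"
      unfolding \<eta>1_def \<eta>2_def x_def[symmetric] y_def[symmetric] primitive_arc[OF x] primitive_arc[OF y] .
    moreover have "is_parameter (\<eta>1 t)" "is_parameter (\<eta>2 t)"
      unfolding \<eta>1_def \<eta>2_def x_def[symmetric] y_def[symmetric]
      using is_parameter_arc x y by blast+
    moreover have "same_component (\<eta>1 t) \<alpha>1" "same_component (\<eta>2 t) \<alpha>2"
      unfolding \<eta>1_def \<eta>2_def x_def[symmetric] y_def[symmetric] j1(2) j2(2)
      using same_componentI x y j1 j2 by blast+
    ultimately show ?thesis using \<gamma>_in[OF t] unfolding \<Theta>1_def \<Theta>2_def by simp
  qed
  have ends: "\<eta>1 1 = \<beta>1" "\<eta>2 1 = \<beta>2"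
    unfolding \<eta>1_def \<eta>2_def \<Theta>1_def \<Theta>2_def \<gamma> through ang_q j1(5) j2(5) by simp_all
  show "f_connected h (p1, p2, \<alpha>1, \<alpha>2) (q1, q2, \<beta>1, \<beta>2)"
    unfolding f_connected.simps
    by (rule exI[of _ G], rule exI[of _ G1], rule exI[of _ G2], rule conjI, rule G,
        rule exI[of _ 0], rule exI[of _ 1], rule exI[of _ \<gamma>1], rule exI[of _ \<gamma>2],
        rule exI[of _ "\<lambda>t. primitive (\<eta>1 t)"], rule exI[of _ "\<lambda>t. primitive (\<eta>2 t)"],
        rule exI[of _ \<eta>1], rule exI[of _ \<eta>2], rule conjI, rule zero_less_one,
        (rule conjI, rule \<gamma>)+, rule conjI, rule ballI, erule deformation, rule conjI, (rule ends)+)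
qed

end
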